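(* Let $\tau>0$ and $\lambda_1,\lambda_2\in\mathbb{R}$ with $x_i=1+\tau(1+\lambda_i)>0$, $i=1,2$. Under $\tau\to1/\tau$, $\lambda_i\to\tau\lambda_i$ the reduced distribution $M^\star_{(\tau,\lambda_1,\lambda_2)}$ satisfies $$\mathbf{E}\Bigl[\bigl(M^\star_{(1/\tau,\,\tau\lambda_1,\,\tau\lambda_2)}\bigr)^{q/\tau}\Bigr]=\frac{\Gamma(1-q)}{\Gamma(1-q/\tau)}\,\mathbf{E}\Bigl[\bigl(M^\star_{(\tau,\lambda_1,\lambda_2)}\bigr)^q\Bigr],\qquad\Re(q)<\min(1,\tau,x_1,x_2).$$ In particular $M^\star$ is not involution invariant: for $\tau\neq1$, $\bigl(M^\star_{(1/\tau,\tau\lambda_1,\tau\lambda_2)}\bigr)^{1/\tau}$ and $M^\star_{(\tau,\lambda_1,\lambda_2)}$ are not equal in law.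
   Context: Barnes double gamma function: for $a=(a_1,a_2)$, $a_j>0$, $\zeta_2(s,w\,|\,a)=\sum_{k_1,k_2=0}^\infty(w+k_1a_1+k_2a_2)^{-s}$ for $\Re(s)>2$, $\Re(w)>0$, continued meromorphically in $s$; $\Gamma_2(w\,|\,a)=\exp\bigl(\partial_s\zeta_2(s,w\,|\,a)|_{s=0}\bigr)$. For $a=(a_1,a_2)$, $x=(x_1,x_2)$ with positive entries, $M_{(a,x)}$ is the probability distribution on $(0,\infty)$ with Mellin transform $\mathbf{E}[M_{(a,x)}^q]=\frac{\Gamma_2(x_1-q|a)}{\Gamma_2(x_1|a)}\frac{\Gamma_2(x_2-q|a)}{\Gamma_2(x_2|a)}\frac{\Gamma_2(a_1+a_2-q|a)}{\Gamma_2(a_1+a_2|a)}\frac{\Gamma_2(x_1+x_2-q|a)}{\Gamma_2(x_1+x_2-2q|a)}$, $\Re(q)<\min(x_1,x_2,a_1+a_2)$. $Y(\tau)$ is the Fréchet random variable with density $\tau y^{-1-\tau}\exp(-y^{-\tau})$, $y>0$. The reduced Selberg integral distribution is $M^\star_{(\tau,\lambda_1,\lambda_2)}=M_{(a,x)}\,Y(\tau)$ (independent factors) with $a=(1,\tau)$ and $x=(x_1,x_2)$, $x_i=1+\tau(1+\lambda_i)$. (For $\tau>1$, $\lambda_i>-1/\tau$ it equals $\frac{\Gamma(1-1/\tau)}{2\pi}M_{(\tau,\lambda_1,\lambda_2)}$, where $M_{(\tau,\lambda_1,\lambda_2)}$ is the law on $(0,\infty)$ with $\mathbf{E}[M^q_{(\tau,\lambda_1,\lambda_2)}]=\tau^{q/\tau}(2\pi)^q\Gamma(1-1/\tau)^{-q}\frac{\Gamma_2(x_1-q|a)}{\Gamma_2(x_1|a)}\frac{\Gamma_2(x_2-q|a)}{\Gamma_2(x_2|a)}\frac{\Gamma_2(\tau-q|a)}{\Gamma_2(\tau|a)}\frac{\Gamma_2(x_1+x_2-q|a)}{\Gamma_2(x_1+x_2-2q|a)}$,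 $\Re(q)<\tau$.) *)

theory Defs
  imports "HOL-Probability.Probability" "HOL-Complex_Analysis.Complex_Analysis"
begin

text \<open>
  The meromorphic continuation in \<open>s\<close> of \<open>\<Sum>(w + k\<^sub>1 a\<^sub>1 + k\<^sub>2 a\<^sub>2)\<^sup>-\<^sup>s\<close> from the half plane
  \<open>Re s > 2\<close>. Being nicely meromorphic excludes spurious values at removable singularities and
  fixes the value 0 at poles, so that the continuation is unique as a function on the whole plane.
  It is meaningful for \<open>a\<^sub>1, a\<^sub>2 > 0\<close> and \<open>Re w > 0\<close>; the powers are then principal.
\<close>

definition barnes_zeta2 :: "real \<times> real \<Rightarrow> complex \<Rightarrow> complex \<Rightarrow> complex" where
  "barnes_zeta2 a w = (THE f. f nicely_meromorphic_on UNIV \<and>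
     (\<forall>s. Re s > 2 \<longrightarrow>
       f s = (\<Sum>\<^sub>\<infinity>(k1, k2)\<in>(UNIV :: (nat \<times> nat) set).
                (w + of_nat k1 * of_real (fst a) + of_nat k2 * of_real (snd a)) powr (- s))))"

definition barnes_Gamma2 :: "real \<times> real \<Rightarrow> complex \<Rightarrow> complex" where
  "barnes_Gamma2 a w = exp (deriv (barnes_zeta2 a w) 0)"

definition mellin_M :: "real \<times> real \<Rightarrow> real \<times> real \<Rightarrow> complex \<Rightarrow> complex" where
  "mellin_M a x q =
     (let x1 = complex_of_real (fst x); x2 = complex_of_real (snd x);
          s = complex_of_real (fst a + snd a); G = barnes_Gamma2 a
      in (G (x1 - q) / G x1) * (G (x2 - q) / G x2) * (G (s - q) / G s) *
         (G (x1 + x2 - q) / G (x1 + x2 - 2 * q)))"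

text \<open>
  The complex moment of order \<open>q\<close> of a law on \<open>(0, \<infinity>)\<close>, and its existence.
\<close>

definition moment :: "real measure \<Rightarrow> complex \<Rightarrow> complex" where
  "moment \<mu> q = (\<integral>y. complex_of_real y powr q \<partial>\<mu>)"

definition has_moment :: "real measure \<Rightarrow> complex \<Rightarrow> bool" where
  "has_moment \<mu> q \<longleftrightarrow> integrable \<mu> (\<lambda>y. complex_of_real y powr q)"

definition positive_law :: "real measure \<Rightarrow> bool" where
  "positive_law \<mu> \<longleftrightarrow> prob_space \<mu> \<and> sets \<mu> = sets borel \<and> (AE y in \<mu>. y > 0)"

text \<open>
  The law of \<open>M\<^sub>(\<^sub>a\<^sub>,\<^sub>x\<^sub>)\<close> is specified by its Mellin transform, which determines it
  uniquely; such a law exists for all positive parameters.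
\<close>

definition is_M_law :: "real \<times> real \<Rightarrow> real \<times> real \<Rightarrow> real measure \<Rightarrow> bool" where
  "is_M_law a x \<mu> \<longleftrightarrow> positive_law \<mu> \<and>
     (\<forall>q. Re q < Min {fst x, snd x, fst a + snd a} \<longrightarrow>
        has_moment \<mu> q \<and> moment \<mu> q = mellin_M a x q)"

definition frechet_law :: "real \<Rightarrow> real measure" where
  "frechet_law \<tau> = density lborel
     (\<lambda>y. ennreal (if y > 0 then \<tau> * y powr (- 1 - \<tau>) * exp (- (y powr (- \<tau>))) else 0))"

definition selberg_x :: "real \<Rightarrow> real \<Rightarrow> real" where
  "selberg_x \<tau> l = 1 + \<tau> * (1 + l)"

text \<open>
  The product measure makes the two factors of \<open>M\<^sub>(\<^sub>a\<^sub>,\<^sub>x\<^sub>) Y(\<tau>)\<close> independent.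
\<close>

definition is_reduced_selberg_law :: "real \<Rightarrow> real \<Rightarrow> real \<Rightarrow> real measure \<Rightarrow> bool" where
  "is_reduced_selberg_law \<tau> l1 l2 \<mu> \<longleftrightarrow>
     (\<exists>M. is_M_law (1, \<tau>) (selberg_x \<tau> l1, selberg_x \<tau> l2) M \<and>
          \<mu> = distr (M \<Otimes>\<^sub>M frechet_law \<tau>) borel (\<lambda>(m, y). m * y))"

end

theory Submission
  imports Defs
begin

text \<open>
  Since \<open>1 + \<tau>\<^sup>-\<^sup>1(1 + \<tau>\<lambda>\<^sub>i) = x\<^sub>i/\<tau>\<close>, the involution rescales all arguments of the double gamma functions
  by \<open>1/\<tau>\<close>, and \<open>\<zeta>\<^sub>2(s, w/\<tau> | 1, 1/\<tau>) = \<tau>\<^sup>s \<zeta>\<^sub>2(s, w | 1, \<tau>)\<close> turns into a factor \<open>\<tau>\<close> to the power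
  \<open>\<zeta>\<^sub>2(0, w | 1, \<tau>)\<close>. This exponent is a quadratic polynomial in \<open>w\<close>, and its values cancel in the Mellin
  transform of \<open>M\<^sub>(\<^sub>a\<^sub>,\<^sub>x\<^sub>)\<close>. So only the Frechet factor, with moments \<open>\<Gamma>(1 - q/\<tau>)\<close>, feels the involution.
  Invariance in law would force \<open>\<Gamma>(1 - q) = \<Gamma>(1 - q/\<tau>)\<close> near \<open>q = 0\<close>, against \<open>\<Gamma>'(1) \<noteq> 0\<close>.

  For the continuation of \<open>\<zeta>\<^sub>2\<close>, let \<open>\<Delta>\<close> be the double difference in the directions \<open>a\<^sub>1, a\<^sub>2\<close>. A finite sum
  \<open>F\<^sub>N(s, z) = \<Sum>\<^sub>i\<^sub><\<^sub>N c\<^sub>i (s - 2)\<^sub>i z\<^bsup>2-i-s\<^esup>\<close> satisfies \<open>\<Delta> F\<^sub>N = (s - 1)(s - 2) z\<^bsup>-s\<^esup> - R\<^sub>N\<close>, where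
  \<open>R\<^sub>N\<close> is of size \<open>|z|\<close> to the power \<open>- Re s - N\<close>. Summing over the lattice telescopes to
  \<open>(s - 1)(s - 2) \<zeta>\<^sub>2(s, w) = F\<^sub>N(s, w) + \<Sum> R\<^sub>N(s, w + k\<^sub>1a\<^sub>1 + k\<^sub>2a\<^sub>2)\<close>, whose right-hand side is
  holomorphic for \<open>Re s > 2 - N\<close>.
\<close>

subsection \<open>Double differences of complex powers\<close>

text \<open>The exact modulus carries the factor \<open>exp (- Im p * Arg z)\<close>. Since
  \<open>Arg z\<close> is bounded by pi in absolute value, a bound independent of the direction of
  \<open>z\<close> results.\<close>

lemma norm_powr_le:
  fixes z p :: complex
  shows "norm (z powr p) \<le> norm z powr Re p * exp (pi * \<bar>Im p\<bar>)"
proof -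
  have "- Im p * Arg z \<le> \<bar>Im p\<bar> * \<bar>Arg z\<bar>"
    by (metis abs_ge_self abs_minus_cancel abs_mult)
  also have "\<dots> \<le> \<bar>Im p\<bar> * pi"
    using Arg_bounded[of z] by (intro mult_left_mono) auto
  finally show ?thesis
    by (simp add: norm_powr_complex mult.commute[of pi] mult_left_mono)
qed

lemma norm_le_norm_add_of_real:
  assumes "Re z > 0" "t \<ge> 0"
  shows "norm z \<le> norm (z + of_real t)"
  using assms by (auto simp: cmod_def intro!: real_sqrt_le_mono power_mono)

text \<open>Taylor's formula on the segment from \<open>z\<close> to \<open>z + h\<close>. Moving
  right increases the modulus, so with \<open>Re p + n + 1 \<ge> 0\<close> the bound on the
  derivative of order \<open>n + 1\<close> is largest at the left endpoint \<open>z\<close>.\<close>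

lemma powr_Taylor_bound:
  fixes z p :: complex and h :: real
  assumes "Re z > 0" "h \<ge> 0" and p: "Re p + of_nat (Suc n) \<ge> 0"
  shows "norm ((z + of_real h) powr (- p) -
            (\<Sum>m\<le>n. (- 1) ^ m * pochhammer p m / fact m * of_real (h ^ m) * z powr (- (p + of_nat m))))
         \<le> norm (pochhammer p (Suc n)) * exp (pi * \<bar>Im p\<bar>) * h ^ Suc n / fact n *
            norm z powr (- (Re p + of_nat (Suc n)))"
proof -
  define f where "f = (\<lambda>i x. (- 1) ^ i * pochhammer p i * x powr (- (p + of_nat i)))"
  define B where "B = norm (pochhammer p (Suc n)) * exp (pi * \<bar>Im p\<bar>) *
                        norm z powr (- (Re p + of_nat (Suc n)))"
  let ?S = "closed_segment z (z + of_real h)"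
  have S: "\<exists>t\<ge>0. x = z + of_real t" if "x \<in> ?S" for x
  proof -
    from that obtain u where "0 \<le> u" "x = (1 - u) *\<^sub>R z + u *\<^sub>R (z + of_real h)"
      by (auto simp: closed_segment_def)
    thus ?thesis using assms
      by (intro exI[of _ "u * h"]) (simp add: scaleR_conv_of_real algebra_simps)
  qed
  have "norm (f 0 (z + of_real h) - (\<Sum>i\<le>n. f i z * (z + of_real h - z) ^ i / fact i))
          \<le> B * norm (z + of_real h - z) ^ Suc n / fact n"
  proof (rule complex_Taylor)
    show "convex ?S" by simp
    show "(f i has_field_derivative f (Suc i) x) (at x within ?S)" if "x \<in> ?S" for i x
    proof -
      have "Re x > 0" using S[OF that] assms by auto
      hence "x \<notin> \<real>\<^sub>\<le>\<^sub>0" by (auto simp: complex_nonpos_Reals_iff)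
      have e: "- (p + of_nat (Suc i)) = - (p + of_nat i) - 1" by simp
      show ?thesis using \<open>x \<notin> \<real>\<^sub>\<le>\<^sub>0\<close> unfolding f_def pochhammer_Suc e
        by (auto intro!: derivative_eq_intros simp: algebra_simps)
    qed
    show "norm (f (Suc n) x) \<le> B" if "x \<in> ?S" for x
    proof -
      from S[OF that] obtain t where t: "t \<ge> 0" "x = z + of_real t" by blast
      have "norm (x powr (- (p + of_nat (Suc n)))) \<le>
              norm x powr (- (Re p + of_nat (Suc n))) * exp (pi * \<bar>Im p\<bar>)"
        using norm_powr_le[of x "- (p + of_nat (Suc n))"] by simp
      also have "\<dots> \<le> norm z powr (- (Re p + of_nat (Suc n))) * exp (pi * \<bar>Im p\<bar>)"
        using norm_le_norm_add_of_real[OF assms(1) t(1)] t assms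
        by (intro mult_right_mono powr_mono2') auto
      finally have "norm (pochhammer p (Suc n)) * norm (x powr (- (p + of_nat (Suc n)))) \<le>
         norm (pochhammer p (Suc n)) * (norm z powr (- (Re p + of_nat (Suc n))) * exp (pi * \<bar>Im p\<bar>))"
        by (intro mult_left_mono) auto
      thus ?thesis unfolding f_def B_def by (simp add: norm_mult norm_power mult_ac)
    qed
  qed auto
  thus ?thesis using assms
    by (simp add: f_def B_def norm_power mult_ac)
qed

definition diff2 :: "real \<times> real \<Rightarrow> (complex \<Rightarrow> complex) \<Rightarrow> complex \<Rightarrow> complex" where
  "diff2 a F z = F z - F (z + of_real (fst a)) - F (z + of_real (snd a))
                 + F (z + of_real (fst a + snd a))"

text \<open>This is \<open>m!\<close> times the coefficient of \<open>t^m\<close> in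
  \<open>(1 - exp (a1 t)) (1 - exp (a2 t))\<close>. The summand \<open>0 ^ m\<close> belongs to the
  unshifted corner and equals 1 for \<open>m = 0\<close>.\<close>

definition diff2_coeff :: "real \<times> real \<Rightarrow> nat \<Rightarrow> real" where
  "diff2_coeff a m = 0 ^ m - fst a ^ m - snd a ^ m + (fst a + snd a) ^ m"

lemma diff2_coeff_0 [simp]: "diff2_coeff a 0 = 0"
  and diff2_coeff_1 [simp]: "diff2_coeff a (Suc 0) = 0"
  by (simp_all add: diff2_coeff_def)

text \<open>The Taylor estimate is applied at the four steps 0, \<open>a1\<close>,
  \<open>a2\<close>, \<open>a1 + a2\<close>. The Taylor polynomials combine to the coefficients
  \<open>diff2_coeff\<close>, and the step 0 adds no error.\<close>

lemma diff2_powr_bound: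
  fixes z p :: complex
  assumes "Re z > 0" "fst a > 0" "snd a > 0" and p: "Re p + of_nat (Suc n) \<ge> 0"
  shows "norm (diff2 a (\<lambda>z. z powr (- p)) z -
            (\<Sum>m\<le>n. (- 1) ^ m * pochhammer p m / fact m * of_real (diff2_coeff a m) *
                        z powr (- (p + of_nat m))))
         \<le> norm (pochhammer p (Suc n)) * exp (pi * \<bar>Im p\<bar>) *
            (fst a ^ Suc n + snd a ^ Suc n + (fst a + snd a) ^ Suc n) / fact n *
            norm z powr (- (Re p + of_nat (Suc n)))"
proof -
  define T where "T = (\<lambda>h::real. \<Sum>m\<le>n. (- 1) ^ m * pochhammer p m / fact m * of_real (h ^ m) *
                          z powr (- (p + of_nat m)))"
  define E where "E = (\<lambda>h::real. (z + of_real h) powr (- p) - T h)"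
  define K where "K = norm (pochhammer p (Suc n)) * exp (pi * \<bar>Im p\<bar>) / fact n *
                        norm z powr (- (Re p + of_nat (Suc n)))"
  have E: "norm (E h) \<le> K * h ^ Suc n" if "h \<ge> 0" for h
    using powr_Taylor_bound[OF assms(1) that p] by (simp add: E_def T_def K_def mult_ac)
  have "(\<Sum>m\<le>n. (- 1) ^ m * pochhammer p m / fact m * of_real (diff2_coeff a m) *
                        z powr (- (p + of_nat m)))
        = T 0 - T (fst a) - T (snd a) + T (fst a + snd a)"
    unfolding T_def diff2_coeff_def
    by (simp add: algebra_simps sum.distrib sum_subtractf add_divide_distrib)
  hence "diff2 a (\<lambda>z. z powr (- p)) z -
            (\<Sum>m\<le>n. (- 1) ^ m * pochhammer p m / fact m * of_real (diff2_coeff a m) *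
                        z powr (- (p + of_nat m)))
        = E 0 - E (fst a) - E (snd a) + E (fst a + snd a)"
    by (simp add: diff2_def E_def)
  also have "norm \<dots> \<le> norm (E 0) + norm (E (fst a)) + norm (E (snd a)) + norm (E (fst a + snd a))"
    by (meson norm_triangle_ineq norm_triangle_ineq4 add_mono order_trans order_refl)
  also have "\<dots> \<le> K * 0 ^ Suc n + K * fst a ^ Suc n + K * snd a ^ Suc n + K * (fst a + snd a) ^ Suc n"
    using assms by (intro add_mono E) auto
  finally show ?thesis by (simp add: K_def algebra_simps add_divide_distrib)
qed

text \<open>
  The factor \<open>(s - 2)\<^sub>i\<close> in \<open>zeta2_main\<close> makes the Taylor coefficients of all terms of its double
  difference combine to \<open>(s - 2)\<^sub>n\<^sub>+\<^sub>2\<close>, so that the \<open>c\<^sub>i\<close> solve a convolution equation free of \<open>s\<close>.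
\<close>

definition diff2_fps :: "real \<times> real \<Rightarrow> complex fps" where
  "diff2_fps a = Abs_fps (\<lambda>m. (- 1) ^ m * of_real (diff2_coeff a (m + 2)) / fact (m + 2))"

text \<open>The expansion coefficients of
  \<open>t^2 / ((1 - exp (- a1 t)) (1 - exp (- a2 t)))\<close>, which are double Bernoulli numbers
  up to normalisation. The reciprocal exists because the constant term of \<open>diff2_fps a\<close>
  is \<open>a1 a2\<close>.\<close>

definition zeta2_coeff :: "real \<times> real \<Rightarrow> nat \<Rightarrow> complex" where
  "zeta2_coeff a = fps_nth (inverse (diff2_fps a))"

definition zeta2_main :: "real \<times> real \<Rightarrow> nat \<Rightarrow> complex \<Rightarrow> complex \<Rightarrow> complex" where
  "zeta2_main a N s z =
     (\<Sum>i<N. zeta2_coeff a i * pochhammer (s - 2) i * z powr (- (s - 2 + of_nat i)))"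

definition zeta2_rem :: "real \<times> real \<Rightarrow> nat \<Rightarrow> complex \<Rightarrow> complex \<Rightarrow> complex" where
  "zeta2_rem a N s z = (s - 1) * (s - 2) * z powr (- s) - diff2 a (zeta2_main a N s) z"

lemma diff2_fps_0: "fps_nth (diff2_fps a) 0 = of_real (fst a * snd a)"
  by (simp add: diff2_fps_def diff2_coeff_def numeral_2_eq_2 algebra_simps)

lemma zeta2_coeff_convolution:
  assumes "fst a > 0" "snd a > 0"
  shows "(\<Sum>i\<le>k. zeta2_coeff a i * fps_nth (diff2_fps a) (k - i)) = (if k = 0 then 1 else 0)"
proof -
  have "fps_nth (inverse (diff2_fps a) * diff2_fps a) k = fps_nth 1 k"
    using assms by (subst inverse_mult_eq_1) (auto simp: diff2_fps_0)
  thus ?thesis by (simp add: fps_mult_nth zeta2_coeff_def atLeast0AtMost)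
qed

text \<open>The Taylor polynomials of all summands are cut so that exactly the powers
  \<open>- s - k\<close> with \<open>k < N\<close> occur. Collecting by \<open>k = i + j\<close>,
  the convolution equation removes every \<open>k > 0\<close>, and \<open>k = 0\<close> leaves the
  factor \<open>(s - 2) (s - 1)\<close>.\<close>

lemma zeta2_main_expansion:
  assumes "fst a > 0" "snd a > 0" "N > 0"
  shows "(\<Sum>i<N. zeta2_coeff a i * pochhammer (s - 2) i *
            (\<Sum>m\<le>Suc (N - i). (- 1) ^ m * pochhammer (s - 2 + of_nat i) m / fact m *
                of_real (diff2_coeff a m) * z powr (- (s - 2 + of_nat i + of_nat m))))
         = (s - 1) * (s - 2) * z powr (- s)"
proof -
  let ?g = "\<lambda>i j. zeta2_coeff a i * fps_nth (diff2_fps a) j * pochhammer (s - 2) (i + j + 2) *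
                    z powr (- (s + of_nat (i + j)))"
  have inner: "zeta2_coeff a i * pochhammer (s - 2) i *
            (\<Sum>m\<le>Suc (N - i). (- 1) ^ m * pochhammer (s - 2 + of_nat i) m / fact m *
                of_real (diff2_coeff a m) * z powr (- (s - 2 + of_nat i + of_nat m))) =
          (\<Sum>j<N - i. ?g i j)" for i
  proof -
    have P: "pochhammer (s - 2) (i + j + 2) = pochhammer (s - 2) i * pochhammer (s - 2 + of_nat i) (j + 2)" for j
      using pochhammer_product'[of "s - 2" i "j + 2"] by (simp add: add_ac)
    have e: "s - 2 + of_nat i + of_nat (Suc (Suc j)) = s + of_nat (i + j)" for j
      by simp
    \<comment> \<open>The terms \<open>m = 0\<close> and \<open>m = 1\<close> have coefficient zero;
      the others are indexed by \<open>m = j + 2\<close>.\<close>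
    show ?thesis
      unfolding lessThan_Suc_atMost[symmetric] sum.lessThan_Suc_shift e
      by (simp only: P sum_distrib_left) (simp add: sum_distrib_left diff2_fps_def mult_ac del: of_nat_add pochhammer_Suc)
  qed
  have "(\<Sum>i<N. \<Sum>j<N - i. ?g i j) = (\<Sum>(i, j)\<in>{(i, j). i + j < N}. ?g i j)"
    by (subst sum.Sigma) (auto intro!: sum.cong)
  also have "\<dots> = (\<Sum>k<N. \<Sum>i\<le>k. ?g i (k - i))"
    by (rule sum.triangle_reindex)
  also have "\<dots> = (\<Sum>k<N. (\<Sum>i\<le>k. zeta2_coeff a i * fps_nth (diff2_fps a) (k - i)) *
                      (pochhammer (s - 2) (k + 2) * z powr (- (s + of_nat k))))"
    by (simp add: sum_distrib_right mult.assoc)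
  also have "\<dots> = (\<Sum>k<N. if k = 0 then pochhammer (s - 2) 2 * z powr (- s) else 0)"
    by (intro sum.cong) (auto simp: zeta2_coeff_convolution[OF assms(1,2)] numeral_2_eq_2)
  also have "\<dots> = (s - 1) * (s - 2) * z powr (- s)"
    using assms(3) by (simp add: numeral_2_eq_2 pochhammer_Suc)
  finally show ?thesis by (simp only: inner)
qed

text \<open>The \<open>i\<close>-th summand is expanded to order \<open>N - i + 1\<close>, so that
  all errors share the exponent \<open>- (Re s + N)\<close>. Continuity of \<open>C\<close> is
  recorded to make the bound uniform for \<open>s\<close> in compact sets.\<close>

lemma zeta2_rem_bound:
  assumes a: "fst a > 0" "snd a > 0" and N: "N > 0"
  obtains C where "continuous_on UNIV C"
    "\<And>s z. Re z > 0 \<Longrightarrow> Re s + of_nat N \<ge> 0 \<Longrightarrow>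
       norm (zeta2_rem a N s z) \<le> C s * norm z powr (- (Re s + of_nat N))"
proof
  define H where "H = (\<lambda>n. (fst a ^ Suc n + snd a ^ Suc n + (fst a + snd a) ^ Suc n) / fact n)"
  define C where "C = (\<lambda>s. \<Sum>i<N. norm (zeta2_coeff a i * pochhammer (s - 2) i) *
     (norm (pochhammer (s - 2 + of_nat i) (Suc (Suc (N - i)))) * exp (pi * \<bar>Im s\<bar>) * H (Suc (N - i))))"
  have poch: "continuous_on UNIV (\<lambda>s::complex. pochhammer (s + c) n)" for c n
    by (intro holomorphic_on_imp_continuous_on holomorphic_intros)
  have poch': "continuous_on UNIV (\<lambda>s::complex. pochhammer (s - 2 + c) n)" for c n
    using poch[of "c - 2" n] by (simp add: algebra_simps)
  show "continuous_on UNIV C" unfolding C_def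
    by (intro continuous_intros poch' poch'[of 0, simplified])
  fix s z :: complex assume z: "Re z > 0" and s: "Re s + of_nat N \<ge> 0"
  define D where "D = (\<lambda>i. diff2 a (\<lambda>z. z powr (- (s - 2 + of_nat i))) z)"
  define T where "T = (\<lambda>i. \<Sum>m\<le>Suc (N - i). (- 1) ^ m * pochhammer (s - 2 + of_nat i) m / fact m *
                of_real (diff2_coeff a m) * z powr (- (s - 2 + of_nat i + of_nat m)))"
  have "zeta2_rem a N s z = (\<Sum>i<N. zeta2_coeff a i * pochhammer (s - 2) i * T i) -
                            (\<Sum>i<N. zeta2_coeff a i * pochhammer (s - 2) i * D i)"
    unfolding T_def zeta2_main_expansion[OF a N]
    by (simp add: zeta2_rem_def zeta2_main_def diff2_def D_def algebra_simps sum.distrib sum_subtractf)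
  also have "\<dots> = (\<Sum>i<N. zeta2_coeff a i * pochhammer (s - 2) i * (T i - D i))"
    by (simp add: algebra_simps sum_subtractf)
  also have "norm \<dots> \<le> (\<Sum>i<N. norm (zeta2_coeff a i * pochhammer (s - 2) i) * norm (D i - T i))"
    by (rule sum_norm_le) (simp add: norm_mult norm_minus_commute)
  also have "\<dots> \<le> (\<Sum>i<N. norm (zeta2_coeff a i * pochhammer (s - 2) i) *
     ((norm (pochhammer (s - 2 + of_nat i) (Suc (Suc (N - i)))) * exp (pi * \<bar>Im s\<bar>) * H (Suc (N - i)))
       * norm z powr (- (Re s + of_nat N))))"
  proof (intro sum_mono mult_left_mono)
    fix i assume i: "i \<in> {..<N}"
    have e: "Re (s - 2 + of_nat i) + of_nat (Suc (Suc (N - i))) = Re s + of_nat N"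
      using i by (simp add: of_nat_diff)
    show "norm (D i - T i) \<le> norm (pochhammer (s - 2 + of_nat i) (Suc (Suc (N - i)))) *
        exp (pi * \<bar>Im s\<bar>) * H (Suc (N - i)) * norm z powr (- (Re s + of_nat N))"
      using diff2_powr_bound[OF z a, of "s - 2 + of_nat i" "Suc (N - i)"] s
      unfolding e D_def T_def H_def by (simp add: mult_ac)
  qed auto
  also have "\<dots> = C s * norm z powr (- (Re s + of_nat N))"
    by (simp add: C_def sum_distrib_right mult.assoc)
  finally show "norm (zeta2_rem a N s z) \<le> C s * norm z powr (- (Re s + of_nat N))" .
qed

subsection \<open>Summation over the lattice\<close>

definition lattice_pt :: "real \<times> real \<Rightarrow> complex \<Rightarrow> nat \<times> nat \<Rightarrow> complex" where
  "lattice_pt a w k = w + of_nat (fst k) * of_real (fst a) + of_nat (snd k) * of_real (snd a)"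

lemma Re_lattice_pt:
  assumes "fst a > 0" "snd a > 0" "Re w > 0"
  shows "Re (lattice_pt a w k) > 0"
  using assms by (auto simp: lattice_pt_def intro!: add_pos_nonneg)

lemma norm_lattice_pt_ge:
  assumes "fst a > 0" "snd a > 0" "Re w > 0"
  shows "norm (lattice_pt a w k) \<ge> Min {Re w, fst a, snd a} * (1 + real (fst k) + real (snd k))"
proof -
  let ?d = "Min {Re w, fst a, snd a}"
  have "?d * (1 + real (fst k) + real (snd k)) = ?d + real (fst k) * ?d + real (snd k) * ?d"
    by (simp add: algebra_simps)
  also have "\<dots> \<le> Re w + real (fst k) * fst a + real (snd k) * snd a"
    by (intro add_mono mult_left_mono) auto
  also have "\<dots> = Re (lattice_pt a w k)" by (simp add: lattice_pt_def)
  also have "\<dots> \<le> norm (lattice_pt a w k)" by (rule complex_Re_le_cmod)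
  finally show ?thesis .
qed

text \<open>Both \<open>1 + m\<close> and \<open>1 + n\<close> are at most \<open>1 + m + n\<close>.
  Splitting the power in halves therefore gives a majorant that is a product of two convergent
  series of exponent \<open>\<rho> / 2 > 1\<close>.\<close>

lemma summable_on_lattice_powr:
  assumes "\<rho> > 2"
  shows "(\<lambda>k. (1 + real (fst k) + real (snd k)) powr (- \<rho>)) summable_on (UNIV :: (nat \<times> nat) set)"
proof (rule summable_on_comparison_test)
  define g where "g = (\<lambda>n::nat. (1 + real n) powr (- \<rho> / 2))"
  have "summable (\<lambda>n. of_nat n powr (- \<rho> / 2) :: real)"
    using assms by (subst summable_real_powr_iff) auto
  hence "summable (\<lambda>n. of_nat (Suc n) powr (- \<rho> / 2) :: real)"
    by (subst summable_Suc_iff)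
  hence "summable (\<lambda>n. norm (g n))" by (simp add: g_def add_ac)
  hence g: "g summable_on UNIV" by (rule norm_summable_imp_summable_on)
  have "(\<lambda>(m, n). g m * g n) summable_on (UNIV \<times> UNIV)"
  proof (rule summable_on_SigmaI)
    fix m
    show "((\<lambda>n. case (m, n) of (m, n) \<Rightarrow> g m * g n) has_sum (g m * infsum g UNIV)) UNIV"
      using has_sum_cmult_right[OF has_sum_infsum[OF g]] by simp
    show "(\<lambda>m. g m * infsum g UNIV) summable_on UNIV"
      by (rule summable_on_cmult_left[OF g])
  qed (auto simp: g_def)
  thus "(\<lambda>(m, n). g m * g n) summable_on (UNIV :: (nat \<times> nat) set)" by simp
  fix k :: "nat \<times> nat"
  obtain m n where k: "k = (m, n)" by force
  have "(1 + real m + real n) powr (- \<rho> / 2) \<le> g m" "(1 + real m + real n) powr (- \<rho> / 2) \<le> g n"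
    unfolding g_def using assms by (auto intro!: powr_mono2')
  hence "(1 + real m + real n) powr (- \<rho> / 2) * (1 + real m + real n) powr (- \<rho> / 2) \<le> g m * g n"
    by (intro mult_mono) (auto simp: g_def)
  thus "(1 + real (fst k) + real (snd k)) powr (- \<rho>) \<le> (case k of (m, n) \<Rightarrow> g m * g n)"
    by (simp add: k flip: powr_add)
qed auto

text \<open>Over a square the double difference telescopes in both directions to its four corner
  values, three of which tend to 0. The squares are cofinal among the finite sets, so the
  unconditional sum may be evaluated along them.\<close>

lemma infsum_diff2_lattice:
  fixes F :: "complex \<Rightarrow> complex"
  assumes summable: "(\<lambda>k. diff2 a F (lattice_pt a w k)) summable_on UNIV"
    and lim: "(\<lambda>n. F (lattice_pt a w (n, 0))) \<longlonglongrightarrow> 0" "(\<lambda>n. F (lattice_pt a w (0, n))) \<longlonglongrightarrow> 0"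
             "(\<lambda>n. F (lattice_pt a w (n, n))) \<longlonglongrightarrow> 0"
  shows "(\<Sum>\<^sub>\<infinity>k. diff2 a F (lattice_pt a w k)) = F w"
proof -
  define G where "G = (\<lambda>m n. F (lattice_pt a w (m, n)))"
  have D: "diff2 a F (lattice_pt a w (m, n)) = (G m n - G (Suc m) n) - (G m (Suc n) - G (Suc m) (Suc n))" for m n
    by (simp add: diff2_def G_def lattice_pt_def algebra_simps)
  have sq: "(\<Sum>k\<in>{..<n} \<times> {..<n}. diff2 a F (lattice_pt a w k)) = G 0 0 - G n 0 - G 0 n + G n n" for n
  proof -
    have "(\<Sum>k\<in>{..<n} \<times> {..<n}. diff2 a F (lattice_pt a w k)) =
            (\<Sum>i<n. \<Sum>j<n. (G i j - G (Suc i) j) - (G i (Suc j) - G (Suc i) (Suc j)))"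
      by (simp add: sum.cartesian_product D case_prod_unfold flip: D)
    also have "\<dots> = (\<Sum>i<n. (G i 0 - G (Suc i) 0) - (G i n - G (Suc i) n))"
      by (intro sum.cong refl sum_lessThan_telescope'[where f = "\<lambda>j. G _ j - G (Suc _) j"])
    also have "\<dots> = (G 0 0 - G n 0) - (G 0 n - G n n)"
      by (simp only: sum_subtractf[of "\<lambda>i. G i 0 - G (Suc i) 0"] sum_lessThan_telescope'[where f = "\<lambda>i. G i _"])
    finally show ?thesis by simp
  qed
  have fl: "filterlim (\<lambda>n. {..<n} \<times> {..<n}) (finite_subsets_at_top (UNIV :: (nat \<times> nat) set)) sequentially"
    unfolding filterlim_finite_subsets_at_top
  proof safe
    fix X :: "(nat \<times> nat) set" assume X: "finite X"
    define N where "N = Suc (Max (insert 0 (fst ` X \<union> snd ` X)))"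
    have "fst k < N \<and> snd k < N" if "k \<in> X" for k
      unfolding N_def using X that by (auto simp: less_Suc_eq_le intro!: Max_ge)
    hence "X \<subseteq> {..<n} \<times> {..<n}" if "n \<ge> N" for n using that by force
    thus "\<forall>\<^sub>F n in sequentially. finite ({..<n} \<times> {..<n}) \<and> X \<subseteq> {..<n} \<times> {..<n} \<and> {..<n} \<times> {..<n} \<subseteq> UNIV"
      by (intro eventually_sequentiallyI[of N]) auto
  qed
  have "(sum (\<lambda>k. diff2 a F (lattice_pt a w k)) \<longlongrightarrow> (\<Sum>\<^sub>\<infinity>k. diff2 a F (lattice_pt a w k)))
          (finite_subsets_at_top UNIV)"
    using has_sum_infsum[OF summable] by (simp add: has_sum_def)
  from filterlim_compose[OF this fl]
  have "(\<lambda>n. G 0 0 - G n 0 - G 0 n + G n n) \<longlonglongrightarrow> (\<Sum>\<^sub>\<infinity>k. diff2 a F (lattice_pt a w k))"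
    by (simp add: sq)
  moreover have "(\<lambda>n. G 0 0 - G n 0 - G 0 n + G n n) \<longlonglongrightarrow> G 0 0 - 0 - 0 + 0"
    unfolding G_def by (intro tendsto_intros lim)
  ultimately have "(\<Sum>\<^sub>\<infinity>k. diff2 a F (lattice_pt a w k)) = G 0 0"
    using LIMSEQ_unique by fastforce
  thus ?thesis by (simp add: G_def lattice_pt_def)
qed

lemma zeta2_main_tendsto_0:
  assumes "Re s > 2" and u: "filterlim (\<lambda>n. norm (u n)) at_top sequentially"
  shows "(\<lambda>n. zeta2_main a N s (u n)) \<longlonglongrightarrow> 0"
  unfolding zeta2_main_def
proof (intro tendsto_null_sum tendsto_mult_right_zero)
  fix i
  let ?p = "- (s - 2 + of_nat i)"
  show "(\<lambda>n. u n powr ?p) \<longlonglongrightarrow> 0"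
  proof (rule Lim_null_comparison)
    show "\<forall>\<^sub>F n in sequentially. norm (u n powr ?p) \<le> norm (u n) powr Re ?p * exp (pi * \<bar>Im ?p\<bar>)"
      by (intro always_eventually allI norm_powr_le)
    have "(\<lambda>n. norm (u n) powr Re ?p) \<longlonglongrightarrow> 0"
      using assms(1) by (intro tendsto_neg_powr[OF _ u]) auto
    thus "(\<lambda>n. norm (u n) powr Re ?p * exp (pi * \<bar>Im ?p\<bar>)) \<longlonglongrightarrow> 0"
      by (rule tendsto_mult_left_zero)
  qed
qed

text \<open>The lattice factor carries the fixed exponent \<open>\<rho>\<close> while
  \<open>x\<close> may vary, so that one summable family serves for many \<open>s\<close>. Lowering
  the exponent is legitimate because its base is at least 1.\<close>

lemma norm_powr_lattice_pt_le:
  assumes a: "fst a > 0" "snd a > 0" and w: "Re w > 0" and "\<rho> \<ge> 0" "x \<ge> \<rho>"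
  shows "norm (lattice_pt a w k) powr (- x) \<le>
           Min {Re w, fst a, snd a} powr (- x) * (1 + real (fst k) + real (snd k)) powr (- \<rho>)"
proof -
  have "norm (lattice_pt a w k) powr (- x) \<le>
          (Min {Re w, fst a, snd a} * (1 + real (fst k) + real (snd k))) powr (- x)"
    using assms norm_lattice_pt_ge[OF a w] by (intro powr_mono2') auto
  also have "\<dots> = Min {Re w, fst a, snd a} powr (- x) * (1 + real (fst k) + real (snd k)) powr (- x)"
    using assms by (intro powr_mult)
  also have "\<dots> \<le> Min {Re w, fst a, snd a} powr (- x) * (1 + real (fst k) + real (snd k)) powr (- \<rho>)"
    using assms by (intro mult_left_mono powr_mono) auto
  finally show ?thesis .
qed

section \<open>Continuation of \<open>(s - 1) (s - 2) \<zeta>\<^sub>2(s, w)\<close> to half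
  planes\<close>

definition zeta2_cont :: "real \<times> real \<Rightarrow> nat \<Rightarrow> complex \<Rightarrow> complex \<Rightarrow> complex" where
  "zeta2_cont a N s w = zeta2_main a N s w + (\<Sum>\<^sub>\<infinity>k. zeta2_rem a N s (lattice_pt a w k))"

text \<open>The constant in the remainder bound depends continuously on \<open>s\<close>, hence is
  bounded on \<open>K\<close>. This supplies the majorant for the Weierstrass test.\<close>

lemma zeta2_rem_lattice_majorant:
  assumes a: "fst a > 0" "snd a > 0" and w: "Re w > 0" and N: "N > 0"
    and K: "compact K" "\<And>s. s \<in> K \<Longrightarrow> Re s + of_nat N \<ge> \<rho>" and \<rho>: "\<rho> > 2"
  obtains D where "\<And>k s. s \<in> K \<Longrightarrow>
    norm (zeta2_rem a N s (lattice_pt a w k)) \<le> D * (1 + real (fst k) + real (snd k)) powr (- \<rho>)"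
proof -
  obtain C where C: "continuous_on UNIV C" "\<And>s z. Re z > 0 \<Longrightarrow> Re s + of_nat N \<ge> 0 \<Longrightarrow>
       norm (zeta2_rem a N s z) \<le> C s * norm z powr (- (Re s + of_nat N))"
    using zeta2_rem_bound[OF a N] by blast
  let ?d = "Min {Re w, fst a, snd a}"
  define E where "E = (\<lambda>s. \<bar>C s\<bar> * ?d powr (- (Re s + of_nat N)))"
  have d: "?d > 0" using a w by simp
  have "continuous_on K E" unfolding E_def using d
    by (intro continuous_intros continuous_on_subset[OF C(1)]) auto
  hence "compact (E ` K)" using K(1) by (rule compact_continuous_image)
  then obtain D where D: "\<And>s. s \<in> K \<Longrightarrow> E s \<le> D"
    using compact_imp_bounded[of "E ` K"] by (auto simp: bounded_real dest: abs_le_D1)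
  show ?thesis
  proof (rule that)
    fix k s assume s: "s \<in> K"
    let ?r = "(1 + real (fst k) + real (snd k)) powr (- \<rho>)"
    have "norm (zeta2_rem a N s (lattice_pt a w k)) \<le> C s * norm (lattice_pt a w k) powr (- (Re s + of_nat N))"
      using K(2)[OF s] \<rho> by (intro C Re_lattice_pt a w) auto
    also have "\<dots> \<le> \<bar>C s\<bar> * (?d powr (- (Re s + of_nat N)) * ?r)"
      using K(2)[OF s] \<rho> by (intro mult_mono norm_powr_lattice_pt_le a w) auto
    also have "\<dots> = E s * ?r" by (simp add: E_def)
    also have "\<dots> \<le> D * ?r" using D[OF s] by (intro mult_right_mono) auto
    finally show "norm (zeta2_rem a N s (lattice_pt a w k)) \<le> D * ?r" .
  qed
qed

lemma holomorphic_zeta2_main: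
  assumes "z \<noteq> 0"
  shows "(\<lambda>s. zeta2_main a N s z) holomorphic_on A"
  unfolding zeta2_main_def using assms by (auto intro!: holomorphic_intros)

lemma holomorphic_zeta2_rem:
  assumes "fst a > 0" "snd a > 0" "Re z > 0"
  shows "(\<lambda>s. zeta2_rem a N s z) holomorphic_on A"
proof -
  have "z + of_real h \<noteq> 0" if "h \<ge> 0" for h :: real
    using assms that by (auto simp: complex_eq_iff)
  from this[of "fst a"] this[of "snd a"] this[of "fst a + snd a"] this[of 0] show ?thesis
    unfolding zeta2_rem_def diff2_def using assms
    by (auto intro!: holomorphic_intros holomorphic_zeta2_main)
qed

lemma holomorphic_zeta2_cont:
  assumes a: "fst a > 0" "snd a > 0" and w: "Re w > 0" and N: "N > 0"
  shows "(\<lambda>s. zeta2_cont a N s w) holomorphic_on {s. Re s > 2 - of_nat N}"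
proof -
  have "(\<lambda>s. \<Sum>\<^sub>\<infinity>k. zeta2_rem a N s (lattice_pt a w k)) holomorphic_on {s. Re s > 2 - of_nat N}"
  proof (subst analytic_on_open[symmetric, OF open_halfspace_Re_gt], subst analytic_on_analytic_at, safe)
    fix s0 :: complex assume s0: "Re s0 > 2 - of_nat N"
    \<comment> \<open>Half the distance from \<open>s0\<close> to the boundary line: on the closed
      disc of radius \<open>r\<close> the decay exponent is still at least
      \<open>2 + r > 2\<close>.\<close>
    define r where "r = (Re s0 - (2 - of_nat N)) / 2"
    have r: "r > 0" using s0 by (simp add: r_def)
    have re: "Re s + of_nat N \<ge> 2 + r" if "s \<in> cball s0 r" for s
      using that abs_Re_le_cmod[of "s0 - s"] by (auto simp: dist_norm r_def field_simps)
    obtain D where D: "\<And>k s. s \<in> cball s0 r \<Longrightarrow>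
      norm (zeta2_rem a N s (lattice_pt a w k)) \<le> D * (1 + real (fst k) + real (snd k)) powr (- (2 + r))"
      using zeta2_rem_lattice_majorant[OF a w N compact_cball re, of s0 r] r by auto
    have ul: "uniform_limit (cball s0 r) (\<lambda>X s. \<Sum>k\<in>X. zeta2_rem a N s (lattice_pt a w k))
                 (\<lambda>s. \<Sum>\<^sub>\<infinity>k. zeta2_rem a N s (lattice_pt a w k)) (finite_subsets_at_top UNIV)"
      using r by (intro Weierstrass_m_test_general[OF D] summable_on_cmult_right summable_on_lattice_powr) auto
    have hol: "(\<lambda>s. \<Sum>k\<in>X. zeta2_rem a N s (lattice_pt a w k)) holomorphic_on A" for X A
      using a w by (intro holomorphic_intros holomorphic_zeta2_rem Re_lattice_pt)
    have "(\<lambda>s. \<Sum>\<^sub>\<infinity>k. zeta2_rem a N s (lattice_pt a w k)) holomorphic_on ball s0 r"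
      by (rule holomorphic_uniform_limit[OF _ ul])
         (auto intro!: always_eventually holomorphic_on_imp_continuous_on hol)
    thus "(\<lambda>s. \<Sum>\<^sub>\<infinity>k. zeta2_rem a N s (lattice_pt a w k)) analytic_on {s0}"
      using r by (auto simp: analytic_at intro!: exI[of _ "ball s0 r"])
  qed
  moreover have "w \<noteq> 0" using w by auto
  ultimately show ?thesis
    unfolding zeta2_cont_def by (intro holomorphic_intros holomorphic_zeta2_main)
qed

lemma zeta2_cont_eq_series:
  assumes a: "fst a > 0" "snd a > 0" and w: "Re w > 0" and N: "N > 0" and s: "Re s > 2"
  shows "zeta2_cont a N s w = (s - 1) * (s - 2) * (\<Sum>\<^sub>\<infinity>k. lattice_pt a w k powr (- s))"
proof -
  have S: "(\<lambda>k. lattice_pt a w k powr (- s)) summable_on UNIV"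
  proof (rule abs_summable_summable, rule Infinite_Sum.abs_summable_on_comparison_test')
    let ?d = "Min {Re w, fst a, snd a}"
    show "(\<lambda>k. ?d powr (- Re s) * exp (pi * \<bar>Im s\<bar>) * (1 + real (fst k) + real (snd k)) powr (- Re s)) summable_on UNIV"
      using s by (intro summable_on_cmult_right summable_on_lattice_powr)
    show "norm (lattice_pt a w k powr (- s)) \<le>
            ?d powr (- Re s) * exp (pi * \<bar>Im s\<bar>) * (1 + real (fst k) + real (snd k)) powr (- Re s)" for k
    proof -
      have "norm (lattice_pt a w k powr (- s)) \<le> norm (lattice_pt a w k) powr (- Re s) * exp (pi * \<bar>Im s\<bar>)"
        using norm_powr_le[of "lattice_pt a w k" "- s"] by simp
      also have "\<dots> \<le> ?d powr (- Re s) * (1 + real (fst k) + real (snd k)) powr (- Re s) * exp (pi * \<bar>Im s\<bar>)"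
        using s by (intro mult_right_mono norm_powr_lattice_pt_le a w) auto
      finally show ?thesis by (simp add: mult_ac)
    qed
  qed
  have R: "(\<lambda>k. zeta2_rem a N s (lattice_pt a w k)) summable_on UNIV"
  proof -
    \<comment> \<open>Here the majorant is needed at a single point only: \<open>K\<close> is a
      singleton and \<open>\<rho> = Re s\<close>.\<close>
    have "Re s' + of_nat N \<ge> Re s" if "s' \<in> {s}" for s' using that by simp
    then obtain D where "\<And>k s'. s' \<in> {s} \<Longrightarrow>
        norm (zeta2_rem a N s' (lattice_pt a w k)) \<le> D * (1 + real (fst k) + real (snd k)) powr (- Re s)"
      using zeta2_rem_lattice_majorant[OF a w N compact_insert[OF compact_empty, of s] _ s] by metis
    hence D: "norm (zeta2_rem a N s (lattice_pt a w k)) \<le> D * (1 + real (fst k) + real (snd k)) powr (- Re s)" for k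
      by simp
    have "(\<lambda>k. D * (1 + real (fst k) + real (snd k)) powr (- Re s)) summable_on UNIV"
      using s by (intro summable_on_cmult_right summable_on_lattice_powr)
    from Infinite_Sum.abs_summable_on_comparison_test'[OF this D] show ?thesis
      by (rule abs_summable_summable)
  qed
  have T: "diff2 a (zeta2_main a N s) z = (s - 1) * (s - 2) * z powr (- s) - zeta2_rem a N s z" for z
    by (simp add: zeta2_rem_def)
  have Tsum: "(\<lambda>k. diff2 a (zeta2_main a N s) (lattice_pt a w k)) summable_on UNIV"
  proof -
    have "(\<lambda>k. (s - 1) * (s - 2) * lattice_pt a w k powr (- s) + - zeta2_rem a N s (lattice_pt a w k)) summable_on UNIV"
      by (intro summable_on_add summable_on_cmult_right summable_on_uminus[THEN iffD2] S R)
    thus ?thesis by (simp add: T)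
  qed
  \<comment> \<open>This covers the two axes and the diagonal at once:
    \<open>f n + g n \<ge> n\<close> drives the lattice points to infinity.\<close>
  have lim: "(\<lambda>n. zeta2_main a N s (lattice_pt a w (f n, g n))) \<longlonglongrightarrow> 0"
    if fg: "\<And>n. f n + g n \<ge> n" for f g
  proof (rule zeta2_main_tendsto_0[OF s], rule filterlim_at_top_mono)
    let ?d = "Min {Re w, fst a, snd a}"
    have d: "?d > 0" using a w by simp
    thus "filterlim (\<lambda>n. ?d * real n) at_top sequentially"
      by (intro filterlim_tendsto_pos_mult_at_top[OF tendsto_const] filterlim_real_sequentially)
    have "?d * real n \<le> norm (lattice_pt a w (f n, g n))" for n
    proof -
      have "real n \<le> 1 + real (f n) + real (g n)" using fg[of n] by linarith
      hence "?d * real n \<le> ?d * (1 + real (fst (f n, g n)) + real (snd (f n, g n)))"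
        using d by (intro mult_left_mono) auto
      also have "\<dots> \<le> norm (lattice_pt a w (f n, g n))" by (rule norm_lattice_pt_ge[OF a w])
      finally show ?thesis .
    qed
    thus "\<forall>\<^sub>F n in sequentially. ?d * real n \<le> norm (lattice_pt a w (f n, g n))" by simp
  qed
  have "zeta2_main a N s w = (\<Sum>\<^sub>\<infinity>k. diff2 a (zeta2_main a N s) (lattice_pt a w k))"
    by (rule infsum_diff2_lattice[OF Tsum, symmetric]) (intro lim, simp)+
  also have "\<dots> + (\<Sum>\<^sub>\<infinity>k. zeta2_rem a N s (lattice_pt a w k)) =
      (\<Sum>\<^sub>\<infinity>k. diff2 a (zeta2_main a N s) (lattice_pt a w k) + zeta2_rem a N s (lattice_pt a w k))"
    by (rule infsum_add[OF Tsum R, symmetric])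
  also have "\<dots> = (\<Sum>\<^sub>\<infinity>k. (s - 1) * (s - 2) * lattice_pt a w k powr (- s))"
    by (simp add: T)
  also have "\<dots> = (s - 1) * (s - 2) * (\<Sum>\<^sub>\<infinity>k. lattice_pt a w k powr (- s))"
    by (rule infsum_cmult_right) (use S in auto)
  finally show ?thesis by (simp add: zeta2_cont_def)
qed

text \<open>The value \<open>N = 3\<close> is the least whose half plane \<open>Re s > 2 - N\<close>
  contains 0. At \<open>s = 0\<close> the main part is a quadratic polynomial, whose double
  difference is the constant \<open>2 c0 a1 a2 = 2\<close>. This is exactly
  \<open>(0 - 1) (0 - 2)\<close>, so the remainder vanishes identically.\<close>

lemma zeta2_cont_0:
  assumes a: "fst a > 0" "snd a > 0" and w: "Re w > 0"
  shows "zeta2_cont a 3 0 w = (w ^ 2 - of_real (fst a + snd a) * w) / of_real (fst a * snd a)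
            + 2 * zeta2_coeff a 2"
proof -
  define A B where "A = complex_of_real (fst a)" and "B = complex_of_real (snd a)"
  have AB: "A \<noteq> 0" "B \<noteq> 0" using a by (auto simp: A_def B_def)
  define c0 c1 c2 where "c0 = zeta2_coeff a 0" and "c1 = zeta2_coeff a 1" and "c2 = zeta2_coeff a 2"
  have c0: "c0 * (A * B) = 1"
    using zeta2_coeff_convolution[OF a, of 0] by (simp add: diff2_fps_0 A_def B_def c0_def)
  have f1: "fps_nth (diff2_fps a) 1 = - (A * B * (A + B)) / 2"
    by (simp add: diff2_fps_def diff2_coeff_def eval_nat_numeral field_simps A_def B_def)
  have "c0 * (- (A * B * (A + B)) / 2) + c1 * (A * B) = 0"
    using zeta2_coeff_convolution[OF a, of 1] f1
    by (simp add: diff2_fps_0 c0_def c1_def A_def B_def)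
  hence "c1 * (A * B) = c0 * (A * B) * ((A + B) / 2)"
    by (simp add: field_simps)
  hence "c1 * (A * B) = (A + B) / 2"
    by (simp only: c0 mult_1)
  hence c1: "2 * (c1 * (A * B)) = A + B" by (simp only:) simp
  have main: "zeta2_main a 3 0 z = c0 * z ^ 2 - 2 * c1 * z + 2 * c2" if "z \<noteq> 0" for z
  proof -
    have "- (0 - 2 + of_nat 0) = (2::complex)" "- (0 - 2 + of_nat 1) = (1::complex)"
         "- (0 - 2 + of_nat 2) = (0::complex)" by simp_all
    moreover have "pochhammer (0 - 2 :: complex) 2 = 2"
      by (simp add: numeral_2_eq_2 pochhammer_Suc)
    moreover have "{..<3::nat} = {0, 1, 2}" by auto
    ultimately show ?thesis
      using that unfolding zeta2_main_def by (simp add: c0_def c1_def c2_def)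
  qed
  have rem: "zeta2_rem a 3 0 z = 0" if z: "Re z > 0" for z
  proof -
    \<comment> \<open>The polynomial form of the main part needs a nonzero argument, since
      \<open>0 powr 0\<close> is 0.\<close>
    have "z + of_real h \<noteq> 0" if "h \<ge> 0" for h :: real
      using z that by (auto simp: complex_eq_iff)
    hence nz: "z \<noteq> 0" "z + A \<noteq> 0" "z + B \<noteq> 0" "z + (A + B) \<noteq> 0"
      using a unfolding A_def B_def by (force simp flip: of_real_add)+
    have "diff2 a (zeta2_main a 3 0) z = 2 * (c0 * (A * B))"
      unfolding diff2_def of_real_add A_def[symmetric] B_def[symmetric] main[OF nz(1)] main[OF nz(2)]
        main[OF nz(3)] main[OF nz(4)] by (simp add: algebra_simps power2_eq_square)
    thus ?thesis using nz(1) by (simp add: zeta2_rem_def c0)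
  qed
  have "w \<noteq> 0" using w by auto
  hence "zeta2_cont a 3 0 w = c0 * w ^ 2 - 2 * c1 * w + 2 * c2"
    by (simp add: zeta2_cont_def main rem Re_lattice_pt a w)
  also have "\<dots> = c0 * (A * B) * (w ^ 2 / (A * B)) - 2 * (c1 * (A * B)) * (w / (A * B)) + 2 * c2"
    using AB by simp
  also have "\<dots> = (w ^ 2 - (A + B) * w) / (A * B) + 2 * c2"
    unfolding c0 c1 by (simp add: diff_divide_distrib)
  finally show ?thesis by (simp add: A_def B_def c2_def)
qed

subsection \<open>The double zeta function\<close>

text \<open>The continuations for different \<open>N\<close> agree with the series on
  \<open>Re s > 2\<close>, hence with each other on common half planes by the identity theorem. They
  are glued by letting \<open>N\<close> depend on the real part of \<open>s\<close>.\<close>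

lemma zeta2_entire:
  assumes a: "fst a > 0" "snd a > 0" and w: "Re w > 0"
  obtains G where "G holomorphic_on UNIV"
    "\<And>s. Re s > 2 \<Longrightarrow> G s = (s - 1) * (s - 2) * (\<Sum>\<^sub>\<infinity>k. lattice_pt a w k powr (- s))"
    "G 0 = (w ^ 2 - of_real (fst a + snd a) * w) / of_real (fst a * snd a) + 2 * zeta2_coeff a 2"
proof
  define H where "H = (\<lambda>N s. zeta2_cont a N s w)"
  define n where "n = (\<lambda>s::complex. Suc (nat \<lceil>3 - Re s\<rceil>))"
  have n: "n s > 0" "Re s > 2 - of_nat (n s)" for s
  proof -
    have "3 - Re s \<le> of_int \<lceil>3 - Re s\<rceil>" by (rule le_of_int_ceiling)
    also have "\<dots> \<le> of_nat (nat \<lceil>3 - Re s\<rceil>)" by simp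
    finally show "Re s > 2 - of_nat (n s)" by (simp add: n_def)
  qed (simp add: n_def)
  define G where "G = (\<lambda>s. H (n s) s)"
  have HH: "H N s = H M s" if "0 < N" "N \<le> M" "Re s > 2 - of_nat N" for N M s
  proof (rule analytic_continuation_open
      [where s = "{s. Re s > 2}" and s' = "{s. Re s > 2 - of_nat N}" and f = "H N" and g = "H M"])
    show "H N holomorphic_on {s. Re s > 2 - of_nat N}"
      unfolding H_def by (rule holomorphic_zeta2_cont[OF a w that(1)])
    have "H M holomorphic_on {s. Re s > 2 - of_nat M}"
      unfolding H_def by (rule holomorphic_zeta2_cont[OF a w]) (use that in auto)
    thus "H M holomorphic_on {s. Re s > 2 - of_nat N}"
      by (rule holomorphic_on_subset) (use that in auto)
    show "connected {s. Re s > 2 - of_nat N}"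
      by (intro convex_connected convex_halfspace_Re_gt)
    have "3 \<in> {s. Re s > 2}" by simp
    thus "{s. Re s > 2} \<noteq> {}" by blast
    show "H N z = H M z" if "z \<in> {s. Re s > 2}" for z
      using that \<open>0 < N\<close> \<open>N \<le> M\<close> unfolding H_def
      by (simp add: zeta2_cont_eq_series[OF a w])
  qed (use that in \<open>auto simp: open_halfspace_Re_gt\<close>)
  have G: "G s = H N s" if "0 < N" "Re s > 2 - of_nat N" for N s
  proof (cases "N \<le> n s")
    case True
    show ?thesis unfolding G_def by (rule HH[OF that(1) True that(2), symmetric])
  next
    case False
    show ?thesis unfolding G_def by (rule HH[OF n(1) _ n(2)]) (use False in simp)
  qed
  have "G analytic_on UNIV"
  proof (subst analytic_on_analytic_at, safe)
    fix s0
    have "H (n s0) holomorphic_on {s. Re s > 2 - of_nat (n s0)}"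
      unfolding H_def by (rule holomorphic_zeta2_cont[OF a w n(1)])
    hence "G holomorphic_on {s. Re s > 2 - of_nat (n s0)}"
      by (rule holomorphic_transform) (simp only: mem_Collect_eq G[OF n(1)])
    thus "G analytic_on {s0}"
      using n(2)[of s0] open_halfspace_Re_gt by (auto simp: analytic_at)
  qed
  thus "G holomorphic_on UNIV" by (rule analytic_imp_holomorphic)
  show "G s = (s - 1) * (s - 2) * (\<Sum>\<^sub>\<infinity>k. lattice_pt a w k powr (- s))" if "Re s > 2" for s
    using G[of 1 s] zeta2_cont_eq_series[OF a w, of 1 s] that by (simp add: H_def)
  show "G 0 = (w ^ 2 - of_real (fst a + snd a) * w) / of_real (fst a * snd a) + 2 * zeta2_coeff a 2"
    using G[of 3 0] zeta2_cont_0[OF a w] by (simp add: H_def)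
qed

lemma remove_sings_nicely_meromorphic_eq:
  assumes "f nicely_meromorphic_on A" "z \<in> A"
  shows "remove_sings f z = f z"
  using assms remove_sings_at_pole[of f z] unfolding nicely_meromorphic_on_def by fastforce

text \<open>The difference vanishes on an open set, hence off a sparse set, and so near every point
  with that point removed. A nicely meromorphic function is recovered from its punctured
  neighbourhoods by \<open>remove_sings\<close>.\<close>

lemma nicely_meromorphic_unique:
  assumes f: "f nicely_meromorphic_on UNIV" and g: "g nicely_meromorphic_on UNIV"
    and U: "open U" "U \<noteq> {}" "\<And>s. s \<in> U \<Longrightarrow> f s = g s"
  shows "f = g"
proof
  fix z
  obtain u where u: "u \<in> U" using U by blast
  have ev: "\<forall>\<^sub>F s in at u. f s - g s = 0"
    using U u by (auto simp: eventually_at_topological)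
  have "(\<lambda>s. f s - g s) meromorphic_on UNIV"
    using f g by (auto intro!: meromorphic_intros simp: nicely_meromorphic_on_def)
  from meromorphic_imp_constant_or_avoid[OF this open_UNIV connected_UNIV, of 0]
  have "\<forall>\<^sub>F s in at z. f s - g s = 0"
  proof
    assume "\<forall>\<^sub>\<approx>s\<in>UNIV. f s - g s \<noteq> 0"
    hence "\<forall>\<^sub>F s in at u. f s - g s \<noteq> 0"
      by (subst (asm) eventually_cosparse_open_eq) auto
    with ev have "\<forall>\<^sub>F s in at u. False" by eventually_elim auto
    thus ?thesis by simp
  qed (auto simp: eventually_cosparse_open_eq)
  hence "remove_sings f z = remove_sings g z" by (intro remove_sings_cong) auto
  thus "f z = g z"
    using f g by (simp add: remove_sings_nicely_meromorphic_eq)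
qed

text \<open>This evaluates the definite description once and for all: any entire \<open>G\<close> of
  this kind determines the continuation.\<close>

lemma barnes_zeta2_eq:
  assumes a: "fst a > 0" "snd a > 0" and w: "Re w > 0"
    and G: "G holomorphic_on UNIV"
      "\<And>s. Re s > 2 \<Longrightarrow> G s = (s - 1) * (s - 2) * (\<Sum>\<^sub>\<infinity>k. lattice_pt a w k powr (- s))"
    and s: "s \<noteq> 1" "s \<noteq> 2"
  shows "barnes_zeta2 a w s = G s / ((s - 1) * (s - 2))"
proof -
  define h where "h = (\<lambda>s. G s / ((s - 1) * (s - 2)))"
  \<comment> \<open>The quotient \<open>h\<close> takes the value 0 at 1 and 2 through division by
    zero, which could be spurious if the singularity were removable.\<close>
  define f where "f = remove_sings h"
  let ?S = "\<lambda>s. \<Sum>\<^sub>\<infinity>(k1, k2)\<in>(UNIV :: (nat \<times> nat) set).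
                (w + of_nat k1 * of_real (fst a) + of_nat k2 * of_real (snd a)) powr (- s)"
  have S: "?S s = (\<Sum>\<^sub>\<infinity>k. lattice_pt a w k powr (- s))" for s
    by (simp add: lattice_pt_def case_prod_unfold)
  have anG: "G analytic_on X" for X
    using G(1) by (metis analytic_on_open analytic_on_subset open_UNIV subset_UNIV)
  have "h meromorphic_on UNIV" unfolding h_def
    by (intro meromorphic_intros analytic_on_imp_meromorphic_on anG)
  hence nice: "f nicely_meromorphic_on UNIV"
    unfolding f_def by (rule remove_sings_nicely_meromorphic)
  have fh: "f s = h s" if "s \<noteq> 1" "s \<noteq> 2" for s
    unfolding f_def h_def using that
    by (intro remove_sings_at_analytic analytic_intros anG) auto
  have fS: "f s = ?S s" if s: "Re s > 2" for s
  proof -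
    have "s \<noteq> 1" "s \<noteq> 2" using s by auto
    thus ?thesis using fh G(2)[OF s] unfolding S by (simp add: h_def)
  qed
  have "barnes_zeta2 a w = f"
    unfolding barnes_zeta2_def
  proof (rule the_equality)
    fix g assume g: "g nicely_meromorphic_on UNIV \<and> (\<forall>s. Re s > 2 \<longrightarrow> g s = ?S s)"
    have "3 \<in> {s. Re s > 2}" by simp
    hence "{s. Re s > 2} \<noteq> {}" by blast
    thus "g = f"
      using g fS nice open_halfspace_Re_gt[of 2]
      by (intro nicely_meromorphic_unique[of g f "{s. Re s > 2}"]) auto
  qed (use nice fS in auto)
  thus ?thesis using fh[OF s] by (simp add: h_def)
qed

section \<open>Scaling of the double zeta function and of the Mellin transform\<close>

lemma barnes_zeta2_scale:
  assumes \<tau>: "\<tau> > 0" and w: "Re w > 0" and s: "s \<noteq> 1" "s \<noteq> 2"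
  shows "barnes_zeta2 (1, 1 / \<tau>) (w / of_real \<tau>) s = of_real \<tau> powr s * barnes_zeta2 (1, \<tau>) w s"
proof -
  have w': "Re (w / of_real \<tau>) > 0" using w \<tau> by simp
  obtain G where G: "G holomorphic_on UNIV"
    "\<And>s. Re s > 2 \<Longrightarrow> G s = (s - 1) * (s - 2) * (\<Sum>\<^sub>\<infinity>k. lattice_pt (1, \<tau>) w k powr (- s))"
    using zeta2_entire[of "(1, \<tau>)" w] \<tau> w by auto
  \<comment> \<open>Taking out \<open>1 / \<tau>\<close> turns the periods
    \<open>(1, 1 / \<tau>)\<close> into \<open>(\<tau>, 1)\<close>, hence the swapped index. The
    principal power is multiplicative here because \<open>\<tau>\<close> is a positive real.\<close>
  have pt: "lattice_pt (1, 1 / \<tau>) (w / of_real \<tau>) k powr (- s) =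
              of_real \<tau> powr s * lattice_pt (1, \<tau>) w (prod.swap k) powr (- s)" for k s
  proof -
    let ?z = "lattice_pt (1, \<tau>) w (prod.swap k)"
    have "Re ?z > 0" using \<tau> w by (intro Re_lattice_pt) auto
    hence z: "?z \<noteq> 0" by auto
    have "lattice_pt (1, 1 / \<tau>) (w / of_real \<tau>) k = of_real (1 / \<tau>) * ?z"
      using \<tau> by (simp add: lattice_pt_def field_simps)
    thus ?thesis using z \<tau>
      by (simp add: powr_def Ln_times_of_real Ln_of_real ln_div exp_add exp_diff exp_minus field_simps
          del: of_real_divide)
  qed
  have "(\<Sum>\<^sub>\<infinity>k. lattice_pt (1, 1 / \<tau>) (w / of_real \<tau>) k powr (- s)) =
          of_real \<tau> powr s * (\<Sum>\<^sub>\<infinity>k. lattice_pt (1, \<tau>) w k powr (- s))" for s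
  proof -
    have "(\<Sum>\<^sub>\<infinity>k. lattice_pt (1, 1 / \<tau>) (w / of_real \<tau>) k powr (- s)) =
            of_real \<tau> powr s * (\<Sum>\<^sub>\<infinity>k. lattice_pt (1, \<tau>) w (prod.swap k) powr (- s))"
      by (simp add: pt infsum_cmult_right')
    also have "(\<Sum>\<^sub>\<infinity>k. lattice_pt (1, \<tau>) w (prod.swap k) powr (- s)) =
               (\<Sum>\<^sub>\<infinity>k. lattice_pt (1, \<tau>) w k powr (- s))"
      by (rule infsum_reindex_bij_betw[OF bij_swap])
    finally show ?thesis .
  qed
  hence "barnes_zeta2 (1, 1 / \<tau>) (w / of_real \<tau>) s = of_real \<tau> powr s * G s / ((s - 1) * (s - 2))"
    using \<tau> w' s G by (intro barnes_zeta2_eq[where G = "\<lambda>s. of_real \<tau> powr s * G s"])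
       (auto intro!: holomorphic_intros)
  also have "\<dots> = of_real \<tau> powr s * barnes_zeta2 (1, \<tau>) w s"
    using barnes_zeta2_eq[of "(1, \<tau>)" w G s] \<tau> w s G by simp
  finally show ?thesis .
qed

lemma barnes_zeta2_at_0:
  assumes a: "fst a > 0" "snd a > 0" and w: "Re w > 0"
  shows "barnes_zeta2 a w 0 =
           (w ^ 2 - of_real (fst a + snd a) * w) / of_real (2 * fst a * snd a) + zeta2_coeff a 2"
    and "barnes_zeta2 a w field_differentiable (at 0)"
proof -
  obtain G where G: "G holomorphic_on UNIV"
    "\<And>s. Re s > 2 \<Longrightarrow> G s = (s - 1) * (s - 2) * (\<Sum>\<^sub>\<infinity>k. lattice_pt a w k powr (- s))"
    "G 0 = (w ^ 2 - of_real (fst a + snd a) * w) / of_real (fst a * snd a) + 2 * zeta2_coeff a 2"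
    using zeta2_entire[OF assms] by blast
  note eq = barnes_zeta2_eq[OF assms G(1,2)]
  show "barnes_zeta2 a w 0 =
           (w ^ 2 - of_real (fst a + snd a) * w) / of_real (2 * fst a * snd a) + zeta2_coeff a 2"
    by (simp add: eq G(3) add_divide_distrib mult_ac)
  have "(\<lambda>s. G s / ((s - 1) * (s - 2))) holomorphic_on ball 0 1"
    by (intro holomorphic_intros holomorphic_on_subset[OF G(1)]) auto
  hence "barnes_zeta2 a w holomorphic_on ball 0 1"
    by (rule holomorphic_transform) (subst eq, auto)
  thus "barnes_zeta2 a w field_differentiable (at 0)"
    by (rule holomorphic_on_imp_differentiable_at) auto
qed

text \<open>The product rule for \<open>\<tau> powr s * \<zeta>\<^sub>2(s, w)\<close> at 0, with the
  explicit value of the double zeta function there.\<close>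

lemma deriv_barnes_zeta2_scale:
  assumes \<tau>: "\<tau> > 0" and w: "Re w > 0"
  shows "deriv (barnes_zeta2 (1, 1 / \<tau>) (w / of_real \<tau>)) 0 =
           of_real (ln \<tau>) * ((w ^ 2 - of_real (1 + \<tau>) * w) / of_real (2 * \<tau>) + zeta2_coeff (1, \<tau>) 2)
           + deriv (barnes_zeta2 (1, \<tau>) w) 0"
proof -
  let ?Z = "barnes_zeta2 (1, \<tau>) w"
  have "(?Z has_field_derivative deriv ?Z 0) (at 0)"
    using barnes_zeta2_at_0(2)[of "(1, \<tau>)" w] assms by (simp add: DERIV_deriv_iff_field_differentiable)
  hence "((\<lambda>s. of_real \<tau> powr s * ?Z s) has_field_derivative of_real (ln \<tau>) * ?Z 0 + deriv ?Z 0) (at 0)"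
    using \<tau> by (auto intro!: derivative_eq_intros simp: Ln_of_real)
  hence "(barnes_zeta2 (1, 1 / \<tau>) (w / of_real \<tau>) has_field_derivative
            of_real (ln \<tau>) * ?Z 0 + deriv ?Z 0) (at 0)"
  proof (rule has_field_derivative_transform_within_open[where S = "ball 0 1"])
    show "of_real \<tau> powr s * ?Z s = barnes_zeta2 (1, 1 / \<tau>) (w / of_real \<tau>) s" if "s \<in> ball 0 1" for s
      using that by (intro barnes_zeta2_scale[OF assms, symmetric]) auto
  qed auto
  hence "deriv (barnes_zeta2 (1, 1 / \<tau>) (w / of_real \<tau>)) 0 = of_real (ln \<tau>) * ?Z 0 + deriv ?Z 0"
    by (rule DERIV_imp_deriv)
  thus ?thesis using barnes_zeta2_at_0(1)[of "(1, \<tau>)" w] assms by simp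
qed

text \<open>The bounds on \<open>Re q\<close> keep all eight arguments of the double gamma function
  in the right half plane, where the scaling relation holds.\<close>

lemma mellin_M_involution:
  assumes \<tau>: "\<tau> > 0" and x: "x1 > 0" "x2 > 0" and q: "Re q < x1" "Re q < x2" "Re q < 1 + \<tau>"
  shows "mellin_M (1, 1 / \<tau>) (x1 / \<tau>, x2 / \<tau>) (q / of_real \<tau>) = mellin_M (1, \<tau>) (x1, x2) q"
proof -
  define Z where "Z = (\<lambda>w. deriv (barnes_zeta2 (1, \<tau>) w) 0)"
  define Z' where "Z' = (\<lambda>w. deriv (barnes_zeta2 (1, 1 / \<tau>) w) 0)"
  define T X1 X2 where "T = complex_of_real \<tau>" and "X1 = complex_of_real x1" and "X2 = complex_of_real x2"
  define Q where "Q = (\<lambda>w. (w ^ 2 - (1 + T) * w) / (2 * T) + zeta2_coeff (1, \<tau>) 2)"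
  have T: "T \<noteq> 0" using \<tau> by (simp add: T_def)
  have Z': "Z' (w / T) = of_real (ln \<tau>) * Q w + Z w" if "Re w > 0" for w
    using deriv_barnes_zeta2_scale[OF \<tau> that] by (simp add: Z'_def Z_def Q_def T_def)
  \<comment> \<open>Before division by \<open>2 T\<close>, the squares leave
    \<open>- 2 (1 + T) q\<close> and the linear terms \<open>2 (1 + T) q\<close>; the constants
    cancel in pairs.\<close>
  have "Q (X1 - q) - Q X1 + (Q (X2 - q) - Q X2) + (Q (1 + T - q) - Q (1 + T))
          + (Q (X1 + X2 - q) - Q (X1 + X2 - 2 * q)) = 0"
    using T by (simp add: Q_def field_simps power2_eq_square)
  hence sumQ: "of_real (ln \<tau>) * Q (X1 - q) - of_real (ln \<tau>) * Q X1 +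
          (of_real (ln \<tau>) * Q (X2 - q) - of_real (ln \<tau>) * Q X2) +
          (of_real (ln \<tau>) * Q (1 + T - q) - of_real (ln \<tau>) * Q (1 + T)) +
          (of_real (ln \<tau>) * Q (X1 + X2 - q) - of_real (ln \<tau>) * Q (X1 + X2 - 2 * q)) = 0"
    by (simp flip: right_diff_distrib distrib_left)
  have args: "X1 / T - q / T = (X1 - q) / T" "X2 / T - q / T = (X2 - q) / T"
    "1 + 1 / T = (1 + T) / T" "(1 + T) / T - q / T = (1 + T - q) / T"
    "X1 / T + X2 / T - q / T = (X1 + X2 - q) / T"
    "X1 / T + X2 / T - 2 * (q / T) = (X1 + X2 - 2 * q) / T"
    using T by (auto simp: field_simps)
  have "mellin_M (1, 1 / \<tau>) (x1 / \<tau>, x2 / \<tau>) (q / of_real \<tau>) =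
     exp (Z' (X1 / T - q / T) - Z' (X1 / T) + (Z' (X2 / T - q / T) - Z' (X2 / T)) +
          (Z' (1 + 1 / T - q / T) - Z' (1 + 1 / T)) +
          (Z' (X1 / T + X2 / T - q / T) - Z' (X1 / T + X2 / T - 2 * (q / T))))"
    by (simp add: mellin_M_def barnes_Gamma2_def Let_def Z'_def T_def X1_def X2_def exp_add exp_diff)
  also have "\<dots> = exp (Z (X1 - q) - Z X1 + (Z (X2 - q) - Z X2) + (Z (1 + T - q) - Z (1 + T)) +
          (Z (X1 + X2 - q) - Z (X1 + X2 - 2 * q)))"
    unfolding args
    by (subst (1 2 3 4 5 6 7 8) Z')
       (use assms sumQ in \<open>auto simp: T_def X1_def X2_def algebra_simps intro!: arg_cong[where f = exp]\<close>)
  also have "\<dots> = mellin_M (1, \<tau>) (x1, x2) q"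
    by (simp add: mellin_M_def barnes_Gamma2_def Let_def Z_def T_def X1_def X2_def exp_add exp_diff)
  finally show ?thesis .
qed

subsection \<open>Moments\<close>

text \<open>The substitution \<open>t = y powr (- \<tau>)\<close> maps the half line onto itself and
  turns the Frechet density into \<open>exp (- t)\<close>. With \<open>z - 1 = - q / \<tau>\<close>
  the power \<open>y powr q\<close> becomes \<open>t powr (z - 1)\<close>, which gives Euler's
  integral.\<close>

lemma frechet_change_of_variables:
  fixes \<tau> :: real and q :: complex
  assumes \<tau>: "\<tau> > 0" and q: "Re q < \<tau>"
  defines "f \<equiv> (\<lambda>y. (\<tau> * y powr (- 1 - \<tau>) * exp (- (y powr (- \<tau>)))) *\<^sub>R (complex_of_real y powr q))"
  shows "f absolutely_integrable_on {0<..} \<and> integral {0<..} f = Gamma (1 - q / of_real \<tau>)"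
proof -
  define z where "z = 1 - q / of_real \<tau>"
  have z: "Re z > 0" using assms by (simp add: z_def)
  define F where "F = (\<lambda>t. complex_of_real t powr (z - 1) / of_real (exp t))"
  define g where "g = (\<lambda>y::real. y powr (- \<tau>))"
  have im: "g ` {0<..} = {0<..}"
  proof (intro equalityI subsetI)
    fix t :: real assume "t \<in> {0<..}"
    thus "t \<in> g ` {0<..}" using \<tau>
      by (intro image_eqI[of _ _ "t powr (- 1 / \<tau>)"]) (auto simp: g_def powr_powr)
  qed (auto simp: g_def)
  have inj: "inj_on g {0<..}"
    by (intro inj_onI) (use \<tau> in \<open>auto simp: g_def powr_def\<close>)
  have "(\<lambda>y. \<bar>- \<tau> * y powr (- \<tau> - 1)\<bar> *\<^sub>R F (g y)) absolutely_integrable_on {0<..} \<and>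
        integral {0<..} (\<lambda>y. \<bar>- \<tau> * y powr (- \<tau> - 1)\<bar> *\<^sub>R F (g y)) = Gamma z"
  proof (subst has_absolute_integral_change_of_variables_real)
    show "(g has_field_derivative - \<tau> * y powr (- \<tau> - 1)) (at y within {0<..})" if "y \<in> {0<..}" for y
      using that unfolding g_def by (auto intro!: derivative_eq_intros)
    show "F absolutely_integrable_on g ` {0<..} \<and> integral (g ` {0<..}) F = Gamma z"
      unfolding im F_def using absolutely_integrable_Gamma_integral'[OF z] Gamma_integral_complex'[OF z]
      by (simp add: has_integral_integrable_integral)
  qed (use inj in auto)
  moreover have eq: "\<bar>- \<tau> * y powr (- \<tau> - 1)\<bar> *\<^sub>R F (g y) = f y" if "y \<in> {0<..}" for y
  proof -
    have "complex_of_real (g y) powr (z - 1) = complex_of_real y powr q"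
      using that \<tau> by (simp add: g_def z_def powr_def powr_of_real Ln_of_real flip: of_real_minus)
        (simp add: exp_of_real field_simps)
    moreover have "- \<tau> - 1 = - 1 - \<tau>" by simp
    ultimately show ?thesis using that \<tau>
      by (simp only:) (simp add: f_def F_def g_def scaleR_conv_of_real exp_minus abs_mult field_simps)
  qed
  ultimately show ?thesis
    unfolding z_def by (metis (no_types, lifting) eq integral_cong set_integrable_cong)
qed

lemma frechet_moment:
  fixes \<tau> :: real and q :: complex
  assumes \<tau>: "\<tau> > 0" and q: "Re q < \<tau>"
  shows "has_moment (frechet_law \<tau>) q" "moment (frechet_law \<tau>) q = Gamma (1 - q / of_real \<tau>)"
proof -
  define d where "d = (\<lambda>y. if y > 0 then \<tau> * y powr (- 1 - \<tau>) * exp (- (y powr (- \<tau>))) else 0)"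
  define f where "f = (\<lambda>y. (\<tau> * y powr (- 1 - \<tau>) * exp (- (y powr (- \<tau>)))) *\<^sub>R (complex_of_real y powr q))"
  have d: "d \<in> borel_measurable lborel" "AE y in lborel. 0 \<le> d y" "d \<in> borel_measurable borel"
    using \<tau> unfolding d_def by auto
  have p: "(\<lambda>y. complex_of_real y powr q) \<in> borel_measurable borel"
    by measurable
  have eq: "(\<lambda>y. d y *\<^sub>R (complex_of_real y powr q)) = (\<lambda>y. indicator {0<..} y *\<^sub>R f y)"
    by (auto simp: d_def f_def fun_eq_iff)
  have f: "set_integrable lebesgue {0<..} f" "integral {0<..} f = Gamma (1 - q / of_real \<tau>)"
    using frechet_change_of_variables[OF assms] unfolding f_def by auto
  have m: "(\<lambda>y. d y *\<^sub>R (complex_of_real y powr q)) \<in> borel_measurable lborel"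
    using d p by measurable
  have fr: "frechet_law \<tau> = density lborel (\<lambda>y. ennreal (d y))"
    by (simp add: frechet_law_def d_def)
  have "integrable lborel (\<lambda>y. d y *\<^sub>R (complex_of_real y powr q))"
    using f(1) m unfolding set_integrable_def eq by (simp add: integrable_completion)
  thus "has_moment (frechet_law \<tau>) q"
    unfolding has_moment_def fr using d p by (subst integrable_density) auto
  have "moment (frechet_law \<tau>) q = (\<integral>y. d y *\<^sub>R (complex_of_real y powr q) \<partial>lborel)"
    unfolding moment_def fr using d p by (subst integral_density) auto
  also have "\<dots> = (\<integral>y. d y *\<^sub>R (complex_of_real y powr q) \<partial>lebesgue)"
    using m by (simp add: integral_completion)
  also have "\<dots> = integral {0<..} f"
    using set_lebesgue_integral_eq_integral(2)[OF f(1)] unfolding eq set_lebesgue_integral_def .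
  finally show "moment (frechet_law \<tau>) q = Gamma (1 - q / of_real \<tau>)" using f(2) by simp
qed

text \<open>The total mass is the moment of order zero, \<open>Gamma 1 = 1\<close>. As
  \<open>0 powr 0\<close> is 0, the integrand equals 1 only almost everywhere.\<close>

lemma positive_law_frechet:
  assumes "\<tau> > 0"
  shows "positive_law (frechet_law \<tau>)"
proof -
  have pos: "AE y in frechet_law \<tau>. y > 0"
    unfolding frechet_law_def by (subst AE_density) (auto split: if_splits)
  have i1: "integrable (frechet_law \<tau>) (\<lambda>y. complex_of_real y powr 0)"
    using frechet_moment(1)[OF assms, of 0] assms by (simp add: has_moment_def)
  have ae: "AE y in frechet_law \<tau>. complex_of_real y powr 0 = 1"
    using pos by eventually_elim auto
  have meas: "(\<lambda>y. complex_of_real y powr 0) \<in> borel_measurable (frechet_law \<tau>)"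
    using i1 by auto
  have i2: "integrable (frechet_law \<tau>) (\<lambda>y. 1 :: complex)"
    using i1 integrable_cong_AE[OF meas _ ae] by simp
  have "(\<integral>y. (1::complex) \<partial>frechet_law \<tau>) = 1"
    using frechet_moment(2)[OF assms, of 0] integral_cong_AE[OF meas _ ae] assms
    by (simp add: moment_def)
  hence "measure (frechet_law \<tau>) (space (frechet_law \<tau>)) = 1"
    by (simp add: scaleR_conv_of_real)
  moreover have "finite_measure (frechet_law \<tau>)"
    using i2 by (intro finite_measureI) (auto simp: integrable_iff_bounded top.not_eq_extremum)
  ultimately have "prob_space (frechet_law \<tau>)"
    by (intro prob_spaceI) (simp add: finite_measure.emeasure_eq_measure)
  thus ?thesis unfolding positive_law_def using pos by (simp add: frechet_law_def)
qed

text \<open>Complex powers are multiplicative on positive reals, so the integrand factors almost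
  everywhere and Fubini's theorem applies.\<close>

lemma moment_product:
  fixes M N :: "real measure"
  assumes M: "positive_law M" and N: "positive_law N" and "has_moment M q" "has_moment N q"
  defines "P \<equiv> distr (M \<Otimes>\<^sub>M N) borel (\<lambda>(m, y). m * y)"
  shows "positive_law P" "has_moment P q" "moment P q = moment M q * moment N q"
proof -
  interpret M: prob_space M using M by (simp add: positive_law_def)
  interpret N: prob_space N using N by (simp add: positive_law_def)
  interpret P: pair_prob_space M N ..
  have [measurable_cong]: "sets M = sets borel" "sets N = sets borel"
    using M N by (auto simp: positive_law_def)
  have posM: "AE y in M. y > 0" and posN: "AE y in N. y > 0"
    using M N by (auto simp: positive_law_def)
  have iM: "integrable M (\<lambda>y. complex_of_real y powr q)" and iN: "integrable N (\<lambda>y. complex_of_real y powr q)"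
    using assms by (auto simp: has_moment_def)
  have mult[measurable]: "(\<lambda>(m, y). m * y) \<in> measurable (M \<Otimes>\<^sub>M N) (borel :: real measure)"
    by measurable
  have pos: "AE z in M \<Otimes>\<^sub>M N. fst z > 0 \<and> snd z > 0"
  proof (rule P.AE_pair_measure)
    show "AE x in M. AE y in N. fst (x, y) > 0 \<and> snd (x, y) > 0"
      using posM by eventually_elim (use posN in \<open>eventually_elim, auto\<close>)
  qed measurable
  show "positive_law P"
    unfolding positive_law_def
  proof (intro conjI)
    show "prob_space P" unfolding P_def by (rule P.prob_space_distr) measurable
    show "sets P = sets borel" by (simp add: P_def)
    have "AE z in M \<Otimes>\<^sub>M N. 0 < (case z of (m, y) \<Rightarrow> m * y)"
      using pos by eventually_elim auto
    thus "AE y in P. 0 < y" unfolding P_def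
      by (subst AE_distr_iff) auto
  qed
  have pw: "AE z in M \<Otimes>\<^sub>M N. (case z of (m, y) \<Rightarrow> complex_of_real (m * y) powr q) =
               (case z of (m, y) \<Rightarrow> complex_of_real m powr q * complex_of_real y powr q)"
    using pos by eventually_elim (auto simp: powr_times_real)
  have int: "integrable (M \<Otimes>\<^sub>M N) (\<lambda>(m, y). complex_of_real m powr q * complex_of_real y powr q)"
  proof (rule P.Fubini_integrable)
    show "integrable M (\<lambda>x. \<integral> y. norm (case (x, y) of (m, y) \<Rightarrow> complex_of_real m powr q * complex_of_real y powr q) \<partial>N)"
      using iM by (simp add: norm_mult)
    show "AE x in M. integrable N (\<lambda>y. case (x, y) of (m, y) \<Rightarrow> complex_of_real m powr q * complex_of_real y powr q)"
      using iN by simp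
  qed measurable
  have int': "integrable (M \<Otimes>\<^sub>M N) (\<lambda>(m, y). complex_of_real (m * y) powr q)"
    by (subst integrable_cong_AE[OF _ _ pw]) (use int in measurable)
  show "has_moment P q" unfolding has_moment_def P_def
    by (subst integrable_distr_eq) (use int' in \<open>auto simp: case_prod_unfold\<close>)
  have "moment P q = (\<integral>z. (case z of (m, y) \<Rightarrow> complex_of_real (m * y) powr q) \<partial>(M \<Otimes>\<^sub>M N))"
    unfolding moment_def P_def by (subst integral_distr) (auto simp: case_prod_unfold)
  also have "\<dots> = (\<integral>z. (case z of (m, y) \<Rightarrow> complex_of_real m powr q * complex_of_real y powr q) \<partial>(M \<Otimes>\<^sub>M N))"
    by (rule integral_cong_AE[OF _ _ pw]) measurable
  also have "\<dots> = (\<integral>x. (\<integral>y. complex_of_real x powr q * complex_of_real y powr q \<partial>N) \<partial>M)"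
    using P.integral_fst'[OF int] by simp
  also have "\<dots> = moment M q * moment N q"
    by (simp add: moment_def)
  finally show "moment P q = moment M q * moment N q" .
qed

lemma moment_distr_powr:
  assumes "positive_law \<mu>"
  shows "moment (distr \<mu> borel (\<lambda>y. y powr c)) q = moment \<mu> (of_real c * q)"
proof -
  have [measurable_cong]: "sets \<mu> = sets borel" and pos: "AE y in \<mu>. y > 0"
    using assms by (auto simp: positive_law_def)
  have "moment (distr \<mu> borel (\<lambda>y. y powr c)) q = (\<integral>y. complex_of_real (y powr c) powr q \<partial>\<mu>)"
    unfolding moment_def by (subst integral_distr) auto
  also have "\<dots> = moment \<mu> (of_real c * q)"
    unfolding moment_def
  proof (rule integral_cong_AE)
    show "AE y in \<mu>. complex_of_real (y powr c) powr q = complex_of_real y powr (of_real c * q)"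
      using pos by eventually_elim (simp add: powr_def Ln_of_real exp_of_real flip: of_real_mult, simp add: Ln_of_real mult_ac)
  qed measurable
  finally show ?thesis .
qed

text \<open>A real order makes the integrand strictly positive almost everywhere, and such an
  integral cannot vanish. It allows the moment to be cancelled in the proof of
  non-invariance.\<close>

lemma moment_of_real_nonzero:
  assumes "positive_law \<mu>" "has_moment \<mu> (of_real r)"
  shows "moment \<mu> (of_real r) \<noteq> 0"
proof
  interpret prob_space \<mu> using assms by (simp add: positive_law_def)
  have [measurable_cong]: "sets \<mu> = sets borel" and pos: "AE y in \<mu>. y > 0"
    using assms by (auto simp: positive_law_def)
  have eq: "AE y in \<mu>. complex_of_real y powr of_real r = of_real (y powr r)"
    using pos by eventually_elim (simp add: powr_of_real)
  have i: "integrable \<mu> (\<lambda>y. complex_of_real (y powr r))"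
    using assms(2) integrable_cong_AE[OF _ _ eq] unfolding has_moment_def by simp
  assume "moment \<mu> (of_real r) = 0"
  hence "(\<integral>y. complex_of_real (y powr r) \<partial>\<mu>) = 0"
    using integral_cong_AE[OF _ _ eq] unfolding moment_def by simp
  hence "(\<integral>y. y powr r \<partial>\<mu>) = 0" by simp
  hence "AE y in \<mu>. y powr r = 0"
    using i by (subst (asm) integral_nonneg_eq_0_iff_AE) (simp_all only: complex_of_real_integrable_eq, auto)
  with pos have "AE y in \<mu>. False" by eventually_elim auto
  thus False by simp
qed

section \<open>The reduced Selberg law under the involution\<close>

text \<open>The derivative of the difference at 0 is \<open>(1 - c)\<close> times the
  Euler-Mascheroni constant, which is nonzero; equality near 0 would force it to vanish.\<close>

lemma Gamma_1_minus_scaled_neq: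
  fixes c \<delta> :: real
  assumes "c \<noteq> 1" "\<delta> > 0"
  shows "\<exists>r. \<bar>r\<bar> < \<delta> \<and> Gamma (1 - r) \<noteq> Gamma (1 - c * r)"
proof (rule ccontr)
  assume "\<not> ?thesis"
  hence eq: "Gamma (1 - r) - Gamma (1 - c * r) = 0" if "\<bar>r\<bar> < \<delta>" for r using that by auto
  have "((\<lambda>r. Gamma (1 - r) - Gamma (1 - c * r)) has_real_derivative
           euler_mascheroni - c * euler_mascheroni) (at 0)"
    by (auto intro!: derivative_eq_intros)
  moreover have "((\<lambda>r. Gamma (1 - r) - Gamma (1 - c * r)) has_real_derivative 0) (at 0)"
  proof (rule has_field_derivative_transform_within_open[where S = "ball 0 \<delta>"])
    show "((\<lambda>_. 0) has_real_derivative 0) (at 0)" by simp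
  qed (use assms eq in auto)
  ultimately have "euler_mascheroni - c * euler_mascheroni = 0"
    by (rule DERIV_unique)
  hence "(1 - c) * euler_mascheroni = 0" by (simp add: algebra_simps)
  thus False using assms euler_mascheroni_pos by simp
qed

lemma reduced_selberg_law_moment:
  assumes \<tau>: "\<tau> > 0" and law: "is_reduced_selberg_law \<tau> l1 l2 \<mu>"
  shows "positive_law \<mu>"
    and "Re q < Min {\<tau>, selberg_x \<tau> l1, selberg_x \<tau> l2} \<Longrightarrow>
          has_moment \<mu> q \<and> moment \<mu> q =
            mellin_M (1, \<tau>) (selberg_x \<tau> l1, selberg_x \<tau> l2) q * Gamma (1 - q / of_real \<tau>)"
proof -
  obtain M where M: "is_M_law (1, \<tau>) (selberg_x \<tau> l1, selberg_x \<tau> l2) M"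
    and \<mu>: "\<mu> = distr (M \<Otimes>\<^sub>M frechet_law \<tau>) borel (\<lambda>(m, y). m * y)"
    using law by (auto simp: is_reduced_selberg_law_def)
  have pos: "positive_law M" using M by (simp add: is_M_law_def)
  note prod = moment_product[OF pos positive_law_frechet[OF \<tau>]]
  \<comment> \<open>Positivity of the product law is obtained from \<open>moment_product\<close> at
    order 0, where the moments always exist.\<close>
  have "has_moment \<nu> 0" if "positive_law \<nu>" for \<nu>
  proof -
    interpret prob_space \<nu> using that by (simp add: positive_law_def)
    have [measurable_cong]: "sets \<nu> = sets borel" using that by (simp add: positive_law_def)
    have "AE y in \<nu>. norm (complex_of_real y powr 0) \<le> 1" by (simp add: powr_def)
    thus ?thesis unfolding has_moment_def by (intro integrable_const_bound[where B = 1]) auto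
  qed
  from prod(1)[OF this this] pos positive_law_frechet[OF \<tau>] show "positive_law \<mu>"
    by (simp add: \<mu>)
  assume q: "Re q < Min {\<tau>, selberg_x \<tau> l1, selberg_x \<tau> l2}"
  hence "has_moment M q" "moment M q = mellin_M (1, \<tau>) (selberg_x \<tau> l1, selberg_x \<tau> l2) q"
    using M \<tau> by (auto simp: is_M_law_def)
  thus "has_moment \<mu> q \<and> moment \<mu> q =
            mellin_M (1, \<tau>) (selberg_x \<tau> l1, selberg_x \<tau> l2) q * Gamma (1 - q / of_real \<tau>)"
    using prod(2,3)[of q] frechet_moment[OF \<tau>, of q] q by (simp add: \<mu>)
qed

theorem corollary5p7:
  fixes \<tau> l1 l2 :: real and \<mu> \<mu>' :: "real measure"
  assumes "\<tau> > 0"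
    and "selberg_x \<tau> l1 > 0" and "selberg_x \<tau> l2 > 0"
    and "is_reduced_selberg_law \<tau> l1 l2 \<mu>"
    and "is_reduced_selberg_law (1 / \<tau>) (\<tau> * l1) (\<tau> * l2) \<mu>'"
  shows "(\<forall>q :: complex. Re q < Min {1, \<tau>, selberg_x \<tau> l1, selberg_x \<tau> l2} \<longrightarrow>
            has_moment \<mu> q \<and> has_moment \<mu>' (q / of_real \<tau>) \<and>
            moment \<mu>' (q / of_real \<tau>) =
              Gamma (1 - q) / Gamma (1 - q / of_real \<tau>) * moment \<mu> q) \<and>
         (\<tau> \<noteq> 1 \<longrightarrow> distr \<mu>' borel (\<lambda>y. y powr (1 / \<tau>)) \<noteq> \<mu>)"
proof (rule conjI)
  let ?x1 = "selberg_x \<tau> l1" and ?x2 = "selberg_x \<tau> l2"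
  have \<tau>: "\<tau> > 0" "1 / \<tau> > 0" using assms by auto
  have x': "selberg_x (1 / \<tau>) (\<tau> * l1) = ?x1 / \<tau>" "selberg_x (1 / \<tau>) (\<tau> * l2) = ?x2 / \<tau>"
    using \<tau> by (auto simp: selberg_x_def field_simps)
  show main: "\<forall>q :: complex. Re q < Min {1, \<tau>, ?x1, ?x2} \<longrightarrow>
            has_moment \<mu> q \<and> has_moment \<mu>' (q / of_real \<tau>) \<and>
            moment \<mu>' (q / of_real \<tau>) =
              Gamma (1 - q) / Gamma (1 - q / of_real \<tau>) * moment \<mu> q"
  proof (intro allI impI)
    fix q :: complex assume q: "Re q < Min {1, \<tau>, ?x1, ?x2}"
    have 1: "has_moment \<mu> q" "moment \<mu> q = mellin_M (1, \<tau>) (?x1, ?x2) q * Gamma (1 - q / of_real \<tau>)"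
      using reduced_selberg_law_moment(2)[OF \<tau>(1) assms(4), of q] q by auto
    have "Re (q / of_real \<tau>) < Min {1 / \<tau>, ?x1 / \<tau>, ?x2 / \<tau>}"
      using q \<tau> by (auto simp: divide_strict_right_mono)
    \<comment> \<open>The Frechet factor now has parameter \<open>1 / \<tau>\<close>, so its moment
      of order \<open>q / \<tau>\<close> is \<open>Gamma (1 - q)\<close>; the condition
      \<open>Re q < 1\<close> is what makes it exist.\<close>
    hence 2: "has_moment \<mu>' (q / of_real \<tau>)" "moment \<mu>' (q / of_real \<tau>) =
        mellin_M (1, 1 / \<tau>) (?x1 / \<tau>, ?x2 / \<tau>) (q / of_real \<tau>) * Gamma (1 - q)"
      using reduced_selberg_law_moment(2)[OF \<tau>(2) assms(5), of "q / of_real \<tau>"] \<tau> unfolding x' by auto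
    have "mellin_M (1, 1 / \<tau>) (?x1 / \<tau>, ?x2 / \<tau>) (q / of_real \<tau>) = mellin_M (1, \<tau>) (?x1, ?x2) q"
      using assms q by (intro mellin_M_involution) auto
    moreover have "Gamma (1 - q / of_real \<tau>) \<noteq> 0"
    proof -
      have "Re (1 - q / of_real \<tau>) > 0" using q \<tau> by simp
      hence "1 - q / of_real \<tau> \<notin> \<int>\<^sub>\<le>\<^sub>0" by (auto elim!: nonpos_Ints_cases simp del: minus_complex.sel)
      thus ?thesis by (simp add: Gamma_eq_zero_iff)
    qed
    ultimately show "has_moment \<mu> q \<and> has_moment \<mu>' (q / of_real \<tau>) \<and>
            moment \<mu>' (q / of_real \<tau>) = Gamma (1 - q) / Gamma (1 - q / of_real \<tau>) * moment \<mu> q"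
      using 1 2 by simp
  qed
  show "\<tau> \<noteq> 1 \<longrightarrow> distr \<mu>' borel (\<lambda>y. y powr (1 / \<tau>)) \<noteq> \<mu>"
  proof (intro impI notI)
    assume "\<tau> \<noteq> 1" and eq: "distr \<mu>' borel (\<lambda>y. y powr (1 / \<tau>)) = \<mu>"
    let ?d = "Min {1, \<tau>, ?x1, ?x2}"
    have "?d > 0" using assms by auto
    \<comment> \<open>A real order inside the common strip where the two gamma factors differ; being
      real, it also gives a nonzero moment.\<close>
    then obtain r where r: "\<bar>r\<bar> < ?d" "Gamma (1 - r) \<noteq> Gamma (1 - (1 / \<tau>) * r)"
      using Gamma_1_minus_scaled_neq[of "1 / \<tau>" ?d] \<open>\<tau> \<noteq> 1\<close> by auto
    define q where "q = complex_of_real r"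
    have q: "Re q < ?d" using r by (auto simp: q_def abs_less_iff)
    have m: "has_moment \<mu> q" "moment \<mu>' (q / of_real \<tau>) =
              Gamma (1 - q) / Gamma (1 - q / of_real \<tau>) * moment \<mu> q"
      using main q by blast+
    \<comment> \<open>Equality in law identifies these moments, so the moment relation forces the
      gamma quotient to be 1.\<close>
    have "moment \<mu> q = moment \<mu>' (q / of_real \<tau>)"
      using moment_distr_powr[OF reduced_selberg_law_moment(1)[OF \<tau>(2) assms(5)], of "1 / \<tau>" q]
      by (simp add: eq)
    moreover have "moment \<mu> q \<noteq> 0"
      using moment_of_real_nonzero[OF reduced_selberg_law_moment(1)[OF \<tau>(1) assms(4)]] m(1)
      unfolding q_def by blast
    ultimately have "Gamma (1 - q) / Gamma (1 - q / of_real \<tau>) = 1"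
      using m(2) by (metis mult_cancel_right1)
    hence "Gamma (1 - q) = Gamma (1 - q / of_real \<tau>)" by (auto simp: divide_eq_1_iff)
    moreover have "1 - q = of_real (1 - r)" "1 - q / of_real \<tau> = of_real (1 - (1 / \<tau>) * r)"
      by (simp_all add: q_def)
    ultimately have "complex_of_real (Gamma (1 - r)) = of_real (Gamma (1 - (1 / \<tau>) * r))"
      by (simp only: Gamma_complex_of_real)
    thus False using r(2) by (simp only: of_real_eq_iff)
  qed
qed

end
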